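(* For every number $m$ of leaves, the dendrogram space $\tilde{\mathcal{T}}_m$ (dendrograms of height $1$, with its geodesic metric) is a CAT(0) space.
   Context: Let $\mathcal{I}_m=\{1,\dots,m\}$ be the set of leaf labels. A weighted rooted tree with $m$ labeled leaves is encoded by edge lengths $d_A\ge 0$ indexed by nonempty proper subsets $A\subsetneq\mathcal{I}_m$: $d_A$ is the length of the edge $e_A$ whose removal separates exactly the leaves in $A$ from the root, and $d_A=0$ if no such edge exists; $e_{\{i\}}$ are the leaf edges, and the $e_A$ with $|A|\ge 2$ are the inner edges. The vectors $(d_A)$ that arise are exactly those satisfying (C1): if $d_A>0$ and $d_B>0$ then $A\subset B$, $B\subset A$ or $A\cap B=\emptyset$. A dendrogram (of height 1) is such a tree in which every leaf has depth one, i.e. (C2): $\sum_{A\ni i,\,A\subsetneq\mathcal{I}_m}d_A=1$ for every $i\in\mathcal{I}_m$. By (C2) the leaf-edge lengths of a dendrogram are determined by the inner-edge lengths, so a dendrogram is identified with its vector $(d_A)_{A\subsetneq\mathcal{I}_m,\,|A|\ge2}$ of nonnegative inner-edge lengths; the set $\tilde{\mathcal{T}}_m$ consists of all such vectors satisfying (C1) and $\sum_{A\ni i,\,|A|\ge 2}d_A\le 1$ for every $i$. The metric on $\tilde{\mathcal{T}}_m$ is the geodesic distance: the length of a shortest path (with respect to Euclidean length in the space of vectors $(d_A)_{|A|\ge2}$) among the paths contained in $\tilde{\mathcal{T}}_m$. CAT(0) has the usual meaning: a geodesic metric space $(\mathcal{X},d)$ is CAT(0) if for all $a,b,c\in\mathcal{X}$,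 every geodesic from $b$ to $c$ and every point $p$ on it, with comparison triangle $a',b',c'$ in $\mathbb{E}^2$ (same side lengths) and $p'\in\overline{b'c'}$ with $\|b'-p'\|=d(b,p)$, one has $d(p,a)\le\|p'-a'\|$. *)

theory Defs
  imports "HOL-Analysis.Analysis"
begin

section \<open>Length metrics\<close>

text \<open>Possibly infinite length of \<^term>\<open>g\<close> on the unit interval with respect to the distance
  \<^term>\<open>d\<close>: the supremum of the lengths of inscribed polygonal chains.\<close>

definition curve_length :: "('a \<Rightarrow> 'a \<Rightarrow> real) \<Rightarrow> (real \<Rightarrow> 'a) \<Rightarrow> ereal" where
  "curve_length d g =
     (SUP ts \<in> {ts. sorted ts \<and> set ts \<subseteq> {0..1}}.
        ereal (\<Sum>i<length ts - 1. d (g (ts ! i)) (g (ts ! Suc i))))"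

text \<open>The distance in \<^term>\<open>S\<close> measured by the \<^term>\<open>d\<close>-lengths of the paths inside \<^term>\<open>S\<close>.
  The infimum is infinite, and the value below the dummy \<open>0\<close>, for points not joined by a
  rectifiable path.\<close>

definition length_dist :: "'a set \<Rightarrow> ('a \<Rightarrow> 'a \<Rightarrow> real) \<Rightarrow> 'a \<Rightarrow> 'a \<Rightarrow> real" where
  "length_dist S d x y =
     real_of_ereal
       (INF g \<in> {g. pathin (Metric_space.mtopology S d) g \<and> g 0 = x \<and> g 1 = y}. curve_length d g)"


section \<open>CAT(0) spaces\<close>

text \<open>Geodesics are parametrised by arc length.\<close>

definition geodesic :: "'a set \<Rightarrow> ('a \<Rightarrow> 'a \<Rightarrow> real) \<Rightarrow> (real \<Rightarrow> 'a) \<Rightarrow> 'a \<Rightarrow> 'a \<Rightarrow> bool" where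
  "geodesic X d \<gamma> x y \<longleftrightarrow>
     \<gamma> ` {0..d x y} \<subseteq> X \<and> \<gamma> 0 = x \<and> \<gamma> (d x y) = y \<and>
     (\<forall>s\<in>{0..d x y}. \<forall>t\<in>{0..d x y}. d (\<gamma> s) (\<gamma> t) = \<bar>s - t\<bar>)"

definition geodesic_metric_space :: "'a set \<Rightarrow> ('a \<Rightarrow> 'a \<Rightarrow> real) \<Rightarrow> bool" where
  "geodesic_metric_space X d \<longleftrightarrow>
     Metric_space X d \<and> (\<forall>x\<in>X. \<forall>y\<in>X. \<exists>\<gamma>. geodesic X d \<gamma> x y)"

text \<open>A comparison triangle always exists by the triangle inequality and is unique up to isometry,
  so quantifying over all of them is the same as choosing one.\<close>

definition CAT0_space :: "'a set \<Rightarrow> ('a \<Rightarrow> 'a \<Rightarrow> real) \<Rightarrow> bool" where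
  "CAT0_space X d \<longleftrightarrow>
     geodesic_metric_space X d \<and>
     (\<forall>a\<in>X. \<forall>b\<in>X. \<forall>c\<in>X. \<forall>\<gamma>. geodesic X d \<gamma> b c \<longrightarrow>
        (\<forall>p \<in> \<gamma> ` {0..d b c}. \<forall>a' b' c' p' :: real ^ 2.
           dist a' b' = d a b \<and> dist b' c' = d b c \<and> dist a' c' = d a c \<and>
           p' \<in> closed_segment b' c' \<and> dist b' p' = d b p \<longrightarrow>
           d p a \<le> dist p' a'))"


section \<open>Dendrogram space\<close>

definition inner_edges :: "nat \<Rightarrow> nat set set" where
  "inner_edges m = {A. A \<subset> {1..m} \<and> 2 \<le> card A}"

text \<open>A vector indexed by \<^term>\<open>inner_edges m\<close> is a function on all sets of naturals that
  vanishes off \<^term>\<open>inner_edges m\<close>.\<close>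

definition dendrograms :: "nat \<Rightarrow> (nat set \<Rightarrow> real) set" where
  "dendrograms m =
     {x. (\<forall>A. A \<notin> inner_edges m \<longrightarrow> x A = 0) \<and>
         (\<forall>A\<in>inner_edges m. 0 \<le> x A) \<and>
         (\<forall>A\<in>inner_edges m. \<forall>B\<in>inner_edges m.
            0 < x A \<and> 0 < x B \<longrightarrow> A \<subseteq> B \<or> B \<subseteq> A \<or> A \<inter> B = {}) \<and>
         (\<forall>i\<in>{1..m}. (\<Sum>A | A \<in> inner_edges m \<and> i \<in> A. x A) \<le> 1)}"

definition edge_dist :: "nat \<Rightarrow> (nat set \<Rightarrow> real) \<Rightarrow> (nat set \<Rightarrow> real) \<Rightarrow> real" where
  "edge_dist m x y = L2_set (\<lambda>A. x A - y A) (inner_edges m)"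

definition dendrogram_dist :: "nat \<Rightarrow> (nat set \<Rightarrow> real) \<Rightarrow> (nat set \<Rightarrow> real) \<Rightarrow> real" where
  "dendrogram_dist m = length_dist (dendrograms m) (edge_dist m)"

end

theory Submission
  imports Defs
begin

text \<open>
  Forgetting the height bound, dendrograms with \<open>m\<close> leaves form a space of orthants: a vector of inner
  edge lengths is admissible when any two edges of positive length are nested or disjoint, so the
  space is a union of Euclidean orthants, one for each family of pairwise compatible edges. Which
  families occur is decided by pairs (the complex of orthants is flag), and this is what makes it
  CAT(0). The bound on the heights then cuts out a convex subset.

  Everything is phrased through the Bruhat--Tits form of CAT(0): on a geodesic from \<open>b\<close> to \<open>c\<close> the point
  \<open>p\<close> with parameter \<open>t\<close> satisfies \<open>d(a,p)\<^sup>2 \<le> (1-t) d(a,b)\<^sup>2 + t d(a,c)\<^sup>2 - t(1-t) d(b,c)\<^sup>2\<close> for every \<open>a\<close>,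
  with equality in the plane by Stewart's theorem. A point with this property is called a comparison
  point below, and a metric space with all comparison points is CAT(0) (\<open>CAT0_space\<close>).

  The space of orthants over \<open>V \<union> {v}\<close> is the space over \<open>V\<close> together with a cylinder, the product of a
  half-line for the new coordinate with the space over the link of \<open>v\<close>; the two meet in the space over
  the link, which is convex in both. Hence induction on the number of coordinates reduces the claim
  to Reshetnyak's gluing theorem (\<open>glued_cat0\<close>). Its core is \<open>triangle_gluing\<close>: when two triangles
  that satisfy Stewart's inequality are glued along a side, the right combination of these inequalities
  no longer involves the length of that side, and it is Stewart's inequality for the union.

  During the induction the metric is only known abstractly, through three properties
  (\<open>orthant_metric\<close>): it is Euclidean for two points of a common orthant, it dominates the Euclidean
  distance, and setting a coordinate to zero does not increase it. From these, each coordinate is a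
  convex function along geodesics (\<open>coordinate_convex\<close>). This makes the faces convex, which the
  induction needs, and at the end also the set where all heights are at most \<open>1\<close>.

  Finally, the metric is the length distance of the statement (\<open>length_dist_eq\<close>). A point shares an
  orthant with all points near it, so the metric agrees with the Euclidean distance from each point to
  its neighbours. Therefore no path is shorter than the distance between its ends, while a geodesic is
  a path whose Euclidean length does not exceed that distance.
\<close>

section \<open>Comparison points and the CAT(0) inequality\<close>

text \<open>The Bruhat--Tits inequality for the point that divides the geodesic from \<open>b\<close> to \<open>c\<close> in the ratio
  \<open>t : 1 - t\<close>. The cases \<open>a = b\<close> and \<open>a = c\<close> force the right distances of \<open>p\<close> to \<open>b\<close> and \<open>c\<close>, so
  the inequality itself places \<open>p\<close> between them.\<close>

definition comparison_point ::
    "'a set \<Rightarrow> ('a \<Rightarrow> 'a \<Rightarrow> real) \<Rightarrow> 'a \<Rightarrow> 'a \<Rightarrow> real \<Rightarrow> 'a \<Rightarrow> bool" where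
  "comparison_point X d b c t p \<longleftrightarrow>
     p \<in> X \<and> (\<forall>a\<in>X. (d a p)\<^sup>2 \<le> (1 - t) * (d a b)\<^sup>2 + t * (d a c)\<^sup>2 - t * (1 - t) * (d b c)\<^sup>2)"

lemma comparison_pointD:
  assumes "comparison_point X d b c t p"
  shows "p \<in> X"
    and "a \<in> X \<Longrightarrow> (d a p)\<^sup>2 \<le> (1 - t) * (d a b)\<^sup>2 + t * (d a c)\<^sup>2 - t * (1 - t) * (d b c)\<^sup>2"
  using assms by (auto simp: comparison_point_def)

context Metric_space
begin

lemma comparison_point_swap:
  assumes "comparison_point M d b c t p"
  shows "comparison_point M d c b (1 - t) p"
  using assms unfolding comparison_point_def by (simp add: commute algebra_simps)

lemma comparison_point_dist:
  assumes p: "comparison_point M d b c t p" and bc: "b \<in> M" "c \<in> M" and t: "0 \<le> t" "t \<le> 1"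
  shows "d b p = t * d b c" and "d p c = (1 - t) * d b c"
proof -
  have "(d b p)\<^sup>2 \<le> (t * d b c)\<^sup>2"
    using comparison_pointD(2)[OF p bc(1)] bc by (simp add: power2_eq_square algebra_simps)
  then have 1: "d b p \<le> t * d b c"
    by (rule power2_le_imp_le) (simp add: t)
  have "(d p c)\<^sup>2 \<le> ((1 - t) * d b c)\<^sup>2"
    using comparison_pointD(2)[OF p bc(2)] bc
    by (simp add: commute power2_eq_square algebra_simps)
  then have 2: "d p c \<le> (1 - t) * d b c"
    by (rule power2_le_imp_le) (simp add: t)
  have "d b c \<le> d b p + d p c"
    using triangle bc comparison_pointD(1)[OF p] by blast
  then show "d b p = t * d b c" "d p c = (1 - t) * d b c"
    using 1 2 by (simp_all add: algebra_simps)
qed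

lemma comparison_point_unique:
  assumes p: "comparison_point M d b c t p" and q: "q \<in> M" and t: "0 \<le> t" "t \<le> 1"
    and le: "d b q \<le> t * d b c" "d q c \<le> (1 - t) * d b c"
  shows "q = p"
proof -
  have "(d q b)\<^sup>2 \<le> (t * d b c)\<^sup>2" "(d q c)\<^sup>2 \<le> ((1 - t) * d b c)\<^sup>2"
    using le by (auto intro!: power_mono simp: commute)
  then have "(1 - t) * (d q b)\<^sup>2 \<le> (1 - t) * (t * d b c)\<^sup>2" "t * (d q c)\<^sup>2 \<le> t * ((1 - t) * d b c)\<^sup>2"
    using t by (auto intro!: mult_left_mono)
  then have "(1 - t) * (d q b)\<^sup>2 + t * (d q c)\<^sup>2 - t * (1 - t) * (d b c)\<^sup>2
      \<le> (1 - t) * (t * d b c)\<^sup>2 + t * ((1 - t) * d b c)\<^sup>2 - t * (1 - t) * (d b c)\<^sup>2"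
    by linarith
  also have "\<dots> = 0"
    by algebra
  finally have "(d q p)\<^sup>2 \<le> 0"
    using comparison_pointD(2)[OF p q] by linarith
  then show ?thesis
    using comparison_pointD(1)[OF p] q by simp
qed

text \<open>Two geodesics that end in the same point \<open>c\<close>: the right-hand side is the squared distance of the
  corresponding points in the comparison triangle of \<open>y\<close>, \<open>b\<close>, \<open>c\<close>, by the law of cosines at \<open>c\<close>.\<close>

lemma comparison_point_hinge:
  assumes p: "comparison_point M d b c t p" and q: "comparison_point M d y c r q"
    and "b \<in> M" "c \<in> M" "y \<in> M" and "0 \<le> t" "t \<le> 1" "0 \<le> r" "r \<le> 1"
  shows "(d q p)\<^sup>2 \<le> (1 - r)\<^sup>2 * (d y c)\<^sup>2 + (1 - t)\<^sup>2 * (d b c)\<^sup>2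
    - (1 - r) * (1 - t) * ((d y c)\<^sup>2 + (d b c)\<^sup>2 - (d y b)\<^sup>2)"
proof -
  have "(d q p)\<^sup>2 \<le> (1 - t) * (d q b)\<^sup>2 + t * (d q c)\<^sup>2 - t * (1 - t) * (d b c)\<^sup>2"
    using comparison_pointD(2)[OF p] comparison_pointD(1)[OF q] by blast
  also have "d q c = (1 - r) * d y c"
    using assms by (intro comparison_point_dist(2)[OF q])
  also have "(1 - t) * (d q b)\<^sup>2 \<le> (1 - t) * ((1 - r) * (d y b)\<^sup>2 + r * (d b c)\<^sup>2 - r * (1 - r) * (d y c)\<^sup>2)"
    using comparison_pointD(2)[OF q, of b] assms by (intro mult_left_mono) (auto simp: commute)
  finally show ?thesis
    by (simp add: algebra_simps power2_eq_square)
qed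

text \<open>Subtracting the squared arc length from the squared distance to \<open>a\<close> turns Stewart's inequality into
  the statement that a function lies below its chord. A chord over a part of the interval whose ends
  lie below the long chord lies below it as well.\<close>

lemma comparison_point_concat:
  assumes z: "comparison_point M d b c s z" and p: "comparison_point M d b z t p"
    and bc: "b \<in> M" "c \<in> M" and st: "0 \<le> s" "s \<le> 1" "0 \<le> t" "t \<le> 1"
  shows "comparison_point M d b c (t * s) p"
  unfolding comparison_point_def
proof (intro conjI ballI)
  show "p \<in> M" using p by (rule comparison_pointD)
  fix a assume a: "a \<in> M"
  have "(d a p)\<^sup>2 \<le> (1 - t) * (d a b)\<^sup>2 + t * (d a z)\<^sup>2 - t * (1 - t) * (d b z)\<^sup>2"
    using comparison_pointD(2)[OF p a] .
  also have "d b z = s * d b c"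
    using st by (intro comparison_point_dist(1)[OF z bc])
  also have "t * (d a z)\<^sup>2 \<le> t * ((1 - s) * (d a b)\<^sup>2 + s * (d a c)\<^sup>2 - s * (1 - s) * (d b c)\<^sup>2)"
    using comparison_pointD(2)[OF z a] st by (intro mult_left_mono)
  finally show "(d a p)\<^sup>2 \<le> (1 - t * s) * (d a b)\<^sup>2 + t * s * (d a c)\<^sup>2 - t * s * (1 - t * s) * (d b c)\<^sup>2"
    by (simp add: algebra_simps power2_eq_square)
qed

end

locale cat0 = Metric_space +
  assumes ex_comparison_point:
    "b \<in> M \<Longrightarrow> c \<in> M \<Longrightarrow> 0 \<le> t \<Longrightarrow> t \<le> 1 \<Longrightarrow> \<exists>p. comparison_point M d b c t p"
begin

text \<open>The diagonal from \<open>b\<close> to \<open>c'\<close> cuts the quadrilateral into two hinges, for each of which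
  \<open>comparison_point_hinge\<close> is the intercept theorem.\<close>

lemma dist_convex:
  assumes p: "comparison_point M d b c t p" and q: "comparison_point M d b' c' t q"
    and M: "b \<in> M" "c \<in> M" "b' \<in> M" "c' \<in> M" and t: "0 \<le> t" "t \<le> 1"
  shows "d p q \<le> (1 - t) * d b b' + t * d c c'"
proof -
  obtain r where r: "comparison_point M d b c' t r"
    using ex_comparison_point[of b c' t] assms by blast
  have rM: "p \<in> M" "q \<in> M" "r \<in> M" using p q r by (auto dest: comparison_pointD)
  have "(d q r)\<^sup>2 \<le> ((1 - t) * d b b')\<^sup>2"
    using comparison_point_hinge[OF r q] assms
    by (simp add: algebra_simps power2_eq_square commute)
  then have 1: "d q r \<le> (1 - t) * d b b'"
    by (rule power2_le_imp_le) (simp add: t)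
  have p': "comparison_point M d c b (1 - t) p" and r': "comparison_point M d c' b (1 - t) r"
    using p r by (auto intro: comparison_point_swap)
  have "(d r p)\<^sup>2 \<le> (t * d c c')\<^sup>2"
    using comparison_point_hinge[OF p' r'] assms
    by (simp add: algebra_simps power2_eq_square commute)
  then have 2: "d r p \<le> t * d c c'"
    by (rule power2_le_imp_le) (simp add: t)
  show ?thesis
    using 1 2 triangle[of p r q] rM by (simp add: commute)
qed

text \<open>The comparison points of \<open>b\<close> and \<open>c\<close> form a geodesic: applying the inequality of one of them to
  another bounds their mutual distance from above, the triangle inequality bounds it from below.\<close>

lemma geodesic_exists:
  assumes bc: "b \<in> M" "c \<in> M"
  shows "\<exists>\<gamma>. geodesic M d \<gamma> b c"
proof -
  define L where "L = d b c"
  obtain f where f: "\<And>t. t \<in> {0..1} \<Longrightarrow> comparison_point M d b c t (f t)"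
    using ex_comparison_point[OF bc] by (metis atLeastAtMost_iff)
  have fM: "f t \<in> M" if "t \<in> {0..1}" for t
    using f[OF that] by (rule comparison_pointD)
  have dist: "d b (f t) = t * L" "d (f t) c = (1 - t) * L" if "t \<in> {0..1}" for t
    using comparison_point_dist[OF f[OF that] bc] that by (auto simp: L_def)
  have len: "d (f s) (f t) = \<bar>s - t\<bar> * L" if s: "s \<in> {0..1}" and t: "t \<in> {0..1}" for s t
  proof (rule antisym)
    have "(d (f s) (f t))\<^sup>2 \<le> (1 - t) * (s * L)\<^sup>2 + t * ((1 - s) * L)\<^sup>2 - t * (1 - t) * L\<^sup>2"
      using comparison_pointD(2)[OF f[OF t] fM[OF s]] dist[OF s] by (simp add: commute L_def)
    also have "\<dots> = ((s - t) * L)\<^sup>2"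
      by algebra
    also have "\<dots> = (\<bar>s - t\<bar> * L)\<^sup>2"
      by (simp add: power_mult_distrib)
    finally show "d (f s) (f t) \<le> \<bar>s - t\<bar> * L"
      by (rule power2_le_imp_le) (simp add: L_def)
    have "t * L \<le> s * L + d (f s) (f t)" "s * L \<le> t * L + d (f s) (f t)"
      using triangle[OF bc(1) fM[OF s] fM[OF t]] triangle[OF bc(1) fM[OF t] fM[OF s]]
        dist[OF s] dist[OF t] by (simp_all add: commute)
    then show "\<bar>s - t\<bar> * L \<le> d (f s) (f t)"
      by (auto simp: abs_if algebra_simps)
  qed
  have "f 0 = b" "f 1 = c"
    using dist[of 0] dist[of 1] fM[of 0] fM[of 1] bc by auto
  moreover have "s / L \<in> {0..1}" if "s \<in> {0..L}" for s
    using that by (cases "L = 0") (auto simp: divide_simps)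
  ultimately have "geodesic M d (\<lambda>s. f (s / L)) b c" if "L \<noteq> 0"
    unfolding geodesic_def L_def[symmetric] using that fM len nonneg[of b c]
    by (auto simp: L_def[symmetric] divide_simps abs_if simp flip: diff_divide_distrib)
  moreover have "geodesic M d (\<lambda>s. b) b c" if "L = 0"
    using that bc by (auto simp: geodesic_def L_def)
  ultimately show ?thesis by blast
qed

text \<open>Every point on every geodesic is a comparison point, by uniqueness, and in the plane Stewart's
  theorem is an equality.\<close>

theorem CAT0_space: "CAT0_space M d"
  unfolding CAT0_space_def geodesic_metric_space_def
proof (intro conjI ballI allI impI)
  show "Metric_space M d" by unfold_locales
  show "\<exists>\<gamma>. geodesic M d \<gamma> x y" if "x \<in> M" "y \<in> M" for x y
    using that by (rule geodesic_exists)
  fix a b c \<gamma> p and a' b' c' p' :: "real ^ 2"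
  assume M: "a \<in> M" "b \<in> M" "c \<in> M" and \<gamma>: "geodesic M d \<gamma> b c" and p: "p \<in> \<gamma> ` {0..d b c}"
    and *: "dist a' b' = d a b \<and> dist b' c' = d b c \<and> dist a' c' = d a c \<and>
      p' \<in> closed_segment b' c' \<and> dist b' p' = d b p"
  obtain t where t: "0 \<le> t" "t \<le> 1" and p': "p' = (1 - t) *\<^sub>R b' + t *\<^sub>R c'"
    using * by (auto simp: in_segment)
  have "b' - p' = t *\<^sub>R (b' - c')"
    by (simp add: p' algebra_simps)
  then have bp': "dist b' p' = t * d b c"
    using * t by (metis abs_of_nonneg dist_norm norm_scaleR)
  obtain s where s: "s \<in> {0..d b c}" "p = \<gamma> s"
    using p by blast
  have ends: "\<gamma> 0 = b" "\<gamma> (d b c) = c" "0 \<in> {0..d b c}" "d b c \<in> {0..d b c}"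
    using \<gamma> by (auto simp: geodesic_def)
  have dist: "d (\<gamma> r) (\<gamma> s) = \<bar>r - s\<bar>" "d (\<gamma> s) (\<gamma> r) = \<bar>s - r\<bar>" if "r \<in> {0..d b c}" for r
    using \<gamma> s(1) that by (auto simp: geodesic_def)
  have bp: "d b p = s" and pc: "d p c = d b c - s"
    using dist(1)[OF ends(3)] dist(2)[OF ends(4)] ends s by simp_all
  have pM: "p \<in> M"
    using \<gamma> s unfolding geodesic_def by blast
  obtain q where q: "comparison_point M d b c t q"
    using ex_comparison_point M t by blast
  have "p = q"
    using comparison_point_unique[OF q pM t] bp pc bp' * by (simp add: algebra_simps)
  then have "(d a p)\<^sup>2 \<le> (1 - t) * (dist a' b')\<^sup>2 + t * (dist a' c')\<^sup>2 - t * (1 - t) * (dist b' c')\<^sup>2"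
    using comparison_pointD(2)[OF q M(1)] * by simp
  also have "\<dots> = (dist p' a')\<^sup>2"
    unfolding p' dist_norm power2_norm_eq_inner
    by (simp add: inner_simps inner_commute algebra_simps)
  finally show "d p a \<le> dist p' a'"
    using power2_le_imp_le commute by (metis zero_le_dist)
qed

lemma convex_subspace:
  assumes "S \<subseteq> M"
    and "\<And>b c t p. b \<in> S \<Longrightarrow> c \<in> S \<Longrightarrow> 0 \<le> t \<Longrightarrow> t \<le> 1 \<Longrightarrow> comparison_point M d b c t p \<Longrightarrow> p \<in> S"
  shows "cat0 S d"
proof
  fix b c :: 'a and t :: real
  assume "b \<in> S" "c \<in> S" "0 \<le> t" "t \<le> 1"
  moreover then obtain p where "comparison_point M d b c t p"
    using ex_comparison_point assms(1) by blast
  ultimately have "comparison_point S d b c t p"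
    using assms unfolding comparison_point_def by (meson subsetD assms(2) comparison_point_def)
  then show "\<exists>p. comparison_point S d b c t p" ..
qed (use assms(1) triangle commute zero in \<open>auto simp: subset_iff\<close>)

end

section \<open>Two triangles glued along a side\<close>

text \<open>Equality holds when \<open>a : b = l : (1 - l)\<close>. This replaces the square of a broken line by an
  expression that is linear in the squares of its two parts.\<close>

lemma square_add_le_weighted:
  fixes a b l :: real
  assumes "0 < l" "l < 1"
  shows "(a + b)\<^sup>2 \<le> a\<^sup>2 / l + b\<^sup>2 / (1 - l)"
proof -
  have "a\<^sup>2 / l + b\<^sup>2 / (1 - l) - (a + b)\<^sup>2 = ((1 - l) * a - l * b)\<^sup>2 / (l * (1 - l))"
    using assms by (simp add: field_simps power2_eq_square)
  also have "\<dots> \<ge> 0" using assms by simp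
  finally show ?thesis by linarith
qed

text \<open>Triangles \<open>a y c\<close> and \<open>y b c\<close> have the common side \<open>y c\<close> of length \<open>e\<close>; put \<open>u = ay\<close>, \<open>v = yb\<close>,
  \<open>m = ac\<close>, \<open>l = bc\<close>. A point \<open>p\<close> on \<open>b c\<close> with parameter \<open>t\<close> is reached from \<open>a\<close> through a point \<open>q\<close> on
  \<open>y c\<close> with parameter \<open>r\<close>, and \<open>\<alpha>\<close>, \<open>\<beta>\<close> are the lengths of the two parts of this path, bounded by
  Stewart's inequality and the hinge inequality. The conclusion is Stewart's inequality in a
  triangle whose side from \<open>a\<close> to \<open>b\<close> has length \<open>u + v\<close>.

  The parameter \<open>r\<close> is the one at which the segment from \<open>a\<close> to \<open>p\<close> crosses \<open>y c\<close> when \<open>a\<close>, \<open>y\<close>, \<open>b\<close> are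
  collinear in the plane, and \<open>\<kappa>\<close> is the fraction of that segment spent before the crossing. Dividing
  the two estimates by \<open>\<kappa>\<close> and \<open>1 - \<kappa>\<close> as in \<open>square_add_le_weighted\<close>, the terms in \<open>e\<^sup>2\<close> cancel.
  Since the planar collinear case is an equality, the remaining terms add up to the right-hand side.
  In particular \<open>r\<close> depends on \<open>u\<close>, \<open>v\<close> and \<open>t\<close> alone. The triangle inequalities for \<open>e\<close> and \<open>l\<close>
  settle the degenerate cases \<open>y = a\<close> and \<open>y = b\<close>.\<close>

lemma triangle_gluing:
  fixes u v t :: real
  assumes uv: "0 \<le> u" "0 \<le> v" and t: "0 \<le> t" "t \<le> 1"
  obtains r where "0 \<le> r" "r \<le> 1"
    and "\<And>\<alpha> \<beta> e m l.
      \<alpha>\<^sup>2 \<le> (1 - r) * u\<^sup>2 + r * m\<^sup>2 - r * (1 - r) * e\<^sup>2 \<Longrightarrow>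
      \<beta>\<^sup>2 \<le> (1 - r)\<^sup>2 * e\<^sup>2 + (1 - t)\<^sup>2 * l\<^sup>2 - (1 - r) * (1 - t) * (e\<^sup>2 + l\<^sup>2 - v\<^sup>2) \<Longrightarrow>
      0 \<le> e \<Longrightarrow> 0 \<le> l \<Longrightarrow> e \<le> u + m \<Longrightarrow> l \<le> e + v \<Longrightarrow>
      (\<alpha> + \<beta>)\<^sup>2 \<le> (1 - t) * (u + v)\<^sup>2 + t * m\<^sup>2 - t * (1 - t) * l\<^sup>2"
proof -
  consider "t = 1" | "u = 0" "t < 1" | "v = 0" "t < 1" | "0 < u" "0 < v" "t < 1"
    using uv t by fastforce
  then show ?thesis
  proof cases
    case 1
    show ?thesis by (rule that[of 1]) (auto simp: 1)
  next
    case 2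
    show ?thesis
    proof (rule that[of 0])
      fix \<alpha> \<beta> e m l :: real
      assume *: "\<alpha>\<^sup>2 \<le> (1 - 0) * u\<^sup>2 + 0 * m\<^sup>2 - 0 * (1 - 0) * e\<^sup>2"
        "\<beta>\<^sup>2 \<le> (1 - 0)\<^sup>2 * e\<^sup>2 + (1 - t)\<^sup>2 * l\<^sup>2 - (1 - 0) * (1 - t) * (e\<^sup>2 + l\<^sup>2 - v\<^sup>2)"
        "0 \<le> e" "e \<le> u + m"
      have "t * e\<^sup>2 \<le> t * m\<^sup>2"
        using * t 2 by (intro mult_left_mono power_mono) auto
      moreover have "\<beta>\<^sup>2 \<le> t * e\<^sup>2 - t * (1 - t) * l\<^sup>2 + (1 - t) * v\<^sup>2"
        using *(2) by (simp add: algebra_simps power2_eq_square)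
      ultimately show "(\<alpha> + \<beta>)\<^sup>2 \<le> (1 - t) * (u + v)\<^sup>2 + t * m\<^sup>2 - t * (1 - t) * l\<^sup>2"
        using *(1) 2 by simp
    qed auto
  next
    case 3
    show ?thesis
    proof (rule that[of t])
      fix \<alpha> \<beta> e m l :: real
      assume *: "\<alpha>\<^sup>2 \<le> (1 - t) * u\<^sup>2 + t * m\<^sup>2 - t * (1 - t) * e\<^sup>2"
        "\<beta>\<^sup>2 \<le> (1 - t)\<^sup>2 * e\<^sup>2 + (1 - t)\<^sup>2 * l\<^sup>2 - (1 - t) * (1 - t) * (e\<^sup>2 + l\<^sup>2 - v\<^sup>2)"
        "0 \<le> l" "l \<le> e + v"
      have "t * (1 - t) * l\<^sup>2 \<le> t * (1 - t) * e\<^sup>2"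
        using * t 3 by (intro mult_left_mono power_mono) auto
      moreover have "\<beta>\<^sup>2 \<le> 0"
        using *(2) 3 by (simp add: algebra_simps power2_eq_square)
      ultimately show "(\<alpha> + \<beta>)\<^sup>2 \<le> (1 - t) * (u + v)\<^sup>2 + t * m\<^sup>2 - t * (1 - t) * l\<^sup>2"
        using * 3 by simp
    qed (use t in auto)
  next
    case 4
    \<comment> \<open>With \<open>a\<close> at the origin, the point \<open>\<kappa> p\<close> with \<open>p = (1 - t) b + t c\<close> lies on the line through
      \<open>y = u / (u + v) b\<close> and \<open>c\<close> exactly for this \<open>\<kappa>\<close>, and then it has parameter \<open>\<kappa> t\<close> there.\<close>
    define D where "D = u + (1 - t) * v"
    define \<kappa> where "\<kappa> = u / D"
    have D: "0 < D" "u < D" "0 < D - u"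
      using 4 by (simp_all add: D_def add_pos_pos)
    have l: "0 < \<kappa>" "\<kappa> < 1"
      using D 4 by (auto simp: \<kappa>_def)
    have "\<kappa> * t \<le> 1" using l t by (simp add: mult_le_one)
    have r1: "(1 - \<kappa> * t) / \<kappa> = (1 - t) * (u + v) / u"
      using D 4 by (simp add: \<kappa>_def field_simps) (simp add: D_def algebra_simps)
    have r2: "(1 - \<kappa> * t) / (1 - \<kappa>) = (u + v) / v"
    proof -
      have "1 - \<kappa> = (1 - t) * v / D" "1 - \<kappa> * t = (1 - t) * (u + v) / D"
        using D by (simp_all add: \<kappa>_def field_simps) (simp_all add: D_def algebra_simps)
      then show ?thesis using D 4 by simp
    qed
    show ?thesis
    proof (rule that[of "\<kappa> * t"])
      fix \<alpha> \<beta> e m l :: real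
      let ?r = "\<kappa> * t"
      assume 1: "\<alpha>\<^sup>2 \<le> (1 - ?r) * u\<^sup>2 + ?r * m\<^sup>2 - ?r * (1 - ?r) * e\<^sup>2" (is "_ \<le> ?A")
        and 2: "\<beta>\<^sup>2 \<le> (1 - ?r)\<^sup>2 * e\<^sup>2 + (1 - t)\<^sup>2 * l\<^sup>2 - (1 - ?r) * (1 - t) * (e\<^sup>2 + l\<^sup>2 - v\<^sup>2)"
          (is "_ \<le> ?B")
      have "(\<alpha> + \<beta>)\<^sup>2 \<le> \<alpha>\<^sup>2 / \<kappa> + \<beta>\<^sup>2 / (1 - \<kappa>)"
        using square_add_le_weighted l .
      also have "\<dots> \<le> ?A / \<kappa> + ?B / (1 - \<kappa>)"
        using 1 2 l by (intro add_mono divide_right_mono) auto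
      also have "?A / \<kappa> = ((1 - ?r) / \<kappa>) * u\<^sup>2 + t * m\<^sup>2 - t * (1 - ?r) * e\<^sup>2"
        using l by (simp add: field_simps)
      also have "?B = (1 - \<kappa>) * t * (1 - ?r) * e\<^sup>2 - (1 - \<kappa>) * t * (1 - t) * l\<^sup>2 + (1 - ?r) * (1 - t) * v\<^sup>2"
        by algebra
      also have "\<dots> / (1 - \<kappa>) = t * (1 - ?r) * e\<^sup>2 - t * (1 - t) * l\<^sup>2 + ((1 - ?r) / (1 - \<kappa>)) * (1 - t) * v\<^sup>2"
        using l by (simp add: divide_simps) (simp add: algebra_simps)
      also have "((1 - ?r) / \<kappa>) * u\<^sup>2 = (1 - t) * (u + v) * u"
        unfolding r1 using 4 by (simp add: power2_eq_square)
      also have "((1 - ?r) / (1 - \<kappa>)) * (1 - t) * v\<^sup>2 = (1 - t) * (u + v) * v"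
        unfolding r2 using 4 by (simp add: power2_eq_square)
      finally show "(\<alpha> + \<beta>)\<^sup>2 \<le> (1 - t) * (u + v)\<^sup>2 + t * m\<^sup>2 - t * (1 - t) * l\<^sup>2"
        by (simp add: algebra_simps power2_eq_square)
    qed (use l t \<open>\<kappa> * t \<le> 1\<close> in auto)
  qed
qed

section \<open>Gluing along a convex subspace\<close>

text \<open>A first variation argument. If \<open>z\<close> is where a geodesic from \<open>b\<close> to \<open>c\<close> crosses from one piece to the
  other, then moving \<open>z\<close> to a point \<open>q\<close> close to it in the direction of \<open>a\<close> cannot shorten the path
  through it. Stewart's inequality bounds the lengths of the two parts of the path through \<open>q\<close>, and to
  first order in the parameter of \<open>q\<close> the resulting inequality is the one to be shown at \<open>z\<close>.\<close>

lemma (in Metric_space) comparison_point_crossing: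
  assumes M: "b \<in> M" "c \<in> M" "z \<in> M" and z: "d b c = d b z + d z c" and pos: "0 < d b z" "0 < d z c"
    and ex: "\<And>a t. a \<in> M \<Longrightarrow> 0 \<le> t \<Longrightarrow> t \<le> 1 \<Longrightarrow> \<exists>q. comparison_point M d z a t q"
  shows "comparison_point M d b c (d b z / d b c) z"
  unfolding comparison_point_def
proof (intro conjI ballI)
  show "z \<in> M" by fact
  fix a assume a: "a \<in> M"
  define x y where "x = d b z" and "y = d z c"
  have xy: "0 < x" "0 < y" "d b c = x + y"
    using pos z by (auto simp: x_def y_def)
  \<comment> \<open>\<open>K / (2 x y)\<close> bounds the derivative at \<open>s = 0\<close> of the length of the path through \<open>q\<close>.\<close>
  define K where "K = y * ((d a b)\<^sup>2 - x\<^sup>2 - (d a z)\<^sup>2) + x * ((d a c)\<^sup>2 - y\<^sup>2 - (d a z)\<^sup>2)"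
  have K: "0 \<le> K + s * ((x + y) * (d a z)\<^sup>2)" if s: "0 < s" "s \<le> 1" for s
  proof -
    obtain q where q: "comparison_point M d z a s q"
      using ex[of a s] a s by auto
    have qM: "q \<in> M" using q by (rule comparison_pointD)
    have tangent: "2 * u * v \<le> u\<^sup>2 + v\<^sup>2" for u v :: real
      using zero_le_power2[of "u - v"] by (simp add: power2_diff)
    have "0 \<le> d b q + d q c - x - y"
      using triangle[of b q c] M qM xy by simp
    then have "0 \<le> 2 * x * y * (d b q + d q c - x - y)"
      using xy by simp
    also have "\<dots> = y * (2 * d b q * x - 2 * x\<^sup>2) + x * (2 * d c q * y - 2 * y\<^sup>2)"
      by (simp add: commute[of q c] algebra_simps power2_eq_square)
    also have "\<dots> \<le> y * ((d b q)\<^sup>2 - x\<^sup>2) + x * ((d c q)\<^sup>2 - y\<^sup>2)"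
      using tangent[of "d b q" x] tangent[of "d c q" y] xy by (intro add_mono mult_left_mono) auto
    also have "\<dots> \<le> y * (((1 - s) * x\<^sup>2 + s * (d a b)\<^sup>2 - s * (1 - s) * (d a z)\<^sup>2) - x\<^sup>2)
        + x * (((1 - s) * y\<^sup>2 + s * (d a c)\<^sup>2 - s * (1 - s) * (d a z)\<^sup>2) - y\<^sup>2)"
      using comparison_pointD(2)[OF q M(1)] comparison_pointD(2)[OF q M(2)] xy
      by (intro add_mono mult_left_mono)
        (auto simp: x_def y_def commute[of c] commute[of b a] commute[of z a])
    also have "\<dots> = s * (K + s * ((x + y) * (d a z)\<^sup>2))"
      unfolding K_def by algebra
    finally show ?thesis
      using s by (simp add: zero_le_mult_iff)
  qed
  have "0 \<le> K"
  proof (rule tendsto_lowerbound)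
    show "((\<lambda>s. K + s * ((x + y) * (d a z)\<^sup>2)) \<longlongrightarrow> K) (at_right 0)"
      by (rule tendsto_eq_intros refl | simp)+
    show "\<forall>\<^sub>F s in at_right 0. 0 \<le> K + s * ((x + y) * (d a z)\<^sup>2)"
      using K by (auto simp: eventually_at_right_field intro!: exI[of _ 1])
  qed simp
  then have "(x + y) * (d a z)\<^sup>2 \<le> y * (d a b)\<^sup>2 + x * (d a c)\<^sup>2 - x * y * (x + y)"
    by (simp add: K_def algebra_simps power2_eq_square)
  then have "(d a z)\<^sup>2 \<le> (y * (d a b)\<^sup>2 + x * (d a c)\<^sup>2 - x * y * (x + y)) / (x + y)"
    using xy by (simp add: pos_le_divide_eq mult.commute)
  also have "\<dots> = (1 - x / (x + y)) * (d a b)\<^sup>2 + x / (x + y) * (d a c)\<^sup>2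
      - x / (x + y) * (1 - x / (x + y)) * (x + y)\<^sup>2"
  proof -
    have "1 - x / (x + y) = y / (x + y)" using xy by (simp add: field_simps)
    then show ?thesis
      using xy by (simp add: add_divide_distrib diff_divide_distrib power2_eq_square)
  qed
  finally show "(d a z)\<^sup>2 \<le> (1 - d b z / d b c) * (d a b)\<^sup>2 + d b z / d b c * (d a c)\<^sup>2
      - d b z / d b c * (1 - d b z / d b c) * (d b c)\<^sup>2"
    by (simp add: xy x_def[symmetric])
qed

text \<open>The overlap is convex in both pieces and carries the same geodesics in both. Attainment of the
  shortest connection through the overlap replaces the usual completeness assumption; in a proper
  space it is a compactness argument.\<close>

locale gluing = X1: cat0 X1 d1 + X2: cat0 X2 d2
  for X1 :: "'a set" and d1 and X2 :: "'a set" and d2 +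
  assumes agree: "x \<in> X1 \<inter> X2 \<Longrightarrow> y \<in> X1 \<inter> X2 \<Longrightarrow> d1 x y = d2 x y"
    and convex_overlap: "b \<in> X1 \<inter> X2 \<Longrightarrow> c \<in> X1 \<inter> X2 \<Longrightarrow> 0 \<le> t \<Longrightarrow> t \<le> 1 \<Longrightarrow>
      \<exists>p. comparison_point X1 d1 b c t p \<and> comparison_point X2 d2 b c t p"
    and attained: "x \<in> X1 \<Longrightarrow> y \<in> X2 \<Longrightarrow>
      \<exists>z\<in>X1 \<inter> X2. \<forall>w\<in>X1 \<inter> X2. d1 x z + d2 z y \<le> d1 x w + d2 w y"
begin

lemma swap: "gluing X2 d2 X1 d1"
proof
  show "d2 x y = d1 x y" if "x \<in> X2 \<inter> X1" "y \<in> X2 \<inter> X1" for x y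
    using that agree[of x y] by simp
  show "\<exists>p. comparison_point X2 d2 b c t p \<and> comparison_point X1 d1 b c t p"
    if "b \<in> X2 \<inter> X1" "c \<in> X2 \<inter> X1" "0 \<le> t" "t \<le> 1" for b c t
    using convex_overlap[of b c t] that by blast
  show "\<exists>z\<in>X2 \<inter> X1. \<forall>w\<in>X2 \<inter> X1. d2 x z + d1 z y \<le> d2 x w + d1 w y" if "x \<in> X2" "y \<in> X1" for x y
    using attained[OF that(2,1)] by (simp add: X1.commute X2.commute Int_commute add.commute)
qed

definition cross :: "'a \<Rightarrow> 'a \<Rightarrow> real" where
  "cross x y = (INF z\<in>X1 \<inter> X2. d1 x z + d2 z y)"

text \<open>A \<open>Metric_space\<close> has a symmetric and nonnegative distance on the whole type, hence the value \<open>0\<close> at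
  points outside both pieces.\<close>

definition glued_dist :: "'a \<Rightarrow> 'a \<Rightarrow> real" where
  "glued_dist x y =
    (if x \<in> X1 \<and> y \<in> X1 then d1 x y
     else if x \<in> X2 \<and> y \<in> X2 then d2 x y
     else if x \<in> X1 \<and> y \<in> X2 then cross x y
     else if x \<in> X2 \<and> y \<in> X1 then cross y x
     else 0)"

lemma cross_le: "z \<in> X1 \<inter> X2 \<Longrightarrow> cross x y \<le> d1 x z + d2 z y"
  unfolding cross_def by (rule cINF_lower) (auto intro!: bdd_belowI2[of _ 0])

lemma cross_attained:
  assumes "x \<in> X1" "y \<in> X2"
  obtains z where "z \<in> X1 \<inter> X2" "cross x y = d1 x z + d2 z y"
proof -
  obtain z where z: "z \<in> X1 \<inter> X2" "\<And>w. w \<in> X1 \<inter> X2 \<Longrightarrow> d1 x z + d2 z y \<le> d1 x w + d2 w y"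
    using attained[OF assms] by blast
  have "cross x y = d1 x z + d2 z y"
    unfolding cross_def using z by (intro cInf_eq_minimum) auto
  then show ?thesis using that z by blast
qed

lemma cross_overlap_left:
  assumes "x \<in> X1 \<inter> X2" "y \<in> X2"
  shows "cross x y = d2 x y"
proof (rule antisym)
  show "cross x y \<le> d2 x y"
    using cross_le[of x x y] assms by simp
  obtain z where z: "z \<in> X1 \<inter> X2" "cross x y = d1 x z + d2 z y"
    using cross_attained assms by blast
  then show "d2 x y \<le> cross x y"
    using X2.triangle[of x z y] agree[of x z] assms by simp
qed

lemma cross_overlap_right:
  assumes "x \<in> X1" "y \<in> X1 \<inter> X2"
  shows "cross x y = d1 x y"
proof (rule antisym)
  show "cross x y \<le> d1 x y"
    using cross_le[of y x y] assms by simp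
  obtain z where z: "z \<in> X1 \<inter> X2" "cross x y = d1 x z + d2 z y"
    using cross_attained assms by blast
  then show "d1 x y \<le> cross x y"
    using X1.triangle[of x z y] agree[of z y] assms by simp
qed

lemma glued_dist_11: "x \<in> X1 \<Longrightarrow> y \<in> X1 \<Longrightarrow> glued_dist x y = d1 x y"
  by (simp add: glued_dist_def)

lemma glued_dist_22: "x \<in> X2 \<Longrightarrow> y \<in> X2 \<Longrightarrow> glued_dist x y = d2 x y"
  using agree[of x y] by (auto simp: glued_dist_def)

lemma glued_dist_12: "x \<in> X1 \<Longrightarrow> y \<in> X2 \<Longrightarrow> glued_dist x y = cross x y"
  using cross_overlap_left[of x y] cross_overlap_right[of x y] by (auto simp: glued_dist_def)

lemma glued_dist_commute: "glued_dist x y = glued_dist y x"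
proof (cases "x \<in> X1 \<and> y \<in> X1 \<or> x \<in> X2 \<and> y \<in> X2")
  case True
  then show ?thesis
    using glued_dist_11[of x y] glued_dist_11[of y x] glued_dist_22[of x y] glued_dist_22[of y x] X1.commute[of x y] X2.commute[of x y]
    by metis
next
  case False
  then show ?thesis
    by (cases "x \<in> X1"; cases "y \<in> X1"; cases "x \<in> X2"; cases "y \<in> X2") (simp_all add: glued_dist_def)
qed

lemma glued_dist_21: "x \<in> X2 \<Longrightarrow> y \<in> X1 \<Longrightarrow> glued_dist x y = cross y x"
  unfolding glued_dist_commute[of x y] by (rule glued_dist_12)

lemma cross_nonneg: "x \<in> X1 \<Longrightarrow> y \<in> X2 \<Longrightarrow> 0 \<le> cross x y"
  by (rule cross_attained[of x y]) auto

sublocale glued: Metric_space "X1 \<union> X2" glued_dist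
proof
  show "0 \<le> glued_dist x y" for x y
    by (simp add: glued_dist_def cross_nonneg)
  show "glued_dist x y = glued_dist y x" for x y
    by (rule glued_dist_commute)
  have *: "x = y" if xy: "x \<in> X1" "y \<in> X2" "cross x y = 0" for x y
  proof -
    obtain z where z: "z \<in> X1 \<inter> X2" "d1 x z + d2 z y = 0"
      using cross_attained[OF xy(1,2)] xy(3) by metis
    then have "d1 x z = 0" "d2 z y = 0"
      using X1.nonneg[of x z] X2.nonneg[of z y] by linarith+
    then show ?thesis
      using z xy by simp
  qed
  show "glued_dist x y = 0 \<longleftrightarrow> x = y" if xy: "x \<in> X1 \<union> X2" "y \<in> X1 \<union> X2" for x y
  proof -
    consider "x \<in> X1" "y \<in> X1" | "x \<in> X2" "y \<in> X2" | "x \<in> X1" "y \<in> X2" | "x \<in> X2" "y \<in> X1"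
      using xy by blast
    then have "glued_dist x y = 0 \<Longrightarrow> x = y"
      by cases (auto simp: glued_dist_11 glued_dist_22 glued_dist_12 glued_dist_21 dest: *)
    moreover have "glued_dist x x = 0"
      using xy(1) by (auto simp: glued_dist_11 glued_dist_22)
    ultimately show ?thesis by auto
  qed
  have 112: "cross x z \<le> d1 x y + cross y z" if xyz: "x \<in> X1" "y \<in> X1" "z \<in> X2" for x y z
  proof -
    obtain w where w: "w \<in> X1 \<inter> X2" "cross y z = d1 y w + d2 w z"
      using cross_attained xyz by blast
    then show ?thesis
      using cross_le[of w x z] X1.triangle[of x y w] xyz by simp
  qed
  have 122: "cross x z \<le> cross x y + d2 y z" if xyz: "x \<in> X1" "y \<in> X2" "z \<in> X2" for x y z
  proof -
    obtain w where w: "w \<in> X1 \<inter> X2" "cross x y = d1 x w + d2 w y"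
      using cross_attained xyz by blast
    then show ?thesis
      using cross_le[of w x z] X2.triangle[of w y z] xyz by simp
  qed
  have 121: "d1 x z \<le> cross x y + cross z y" if xyz: "x \<in> X1" "y \<in> X2" "z \<in> X1" for x y z
  proof -
    obtain w where w: "w \<in> X1 \<inter> X2" "cross x y = d1 x w + d2 w y"
      using cross_attained xyz by blast
    obtain v where v: "v \<in> X1 \<inter> X2" "cross z y = d1 z v + d2 v y"
      using cross_attained xyz by blast
    show ?thesis
      using X1.triangle[of x w z] X1.triangle[of w v z] X2.triangle[of w y v] agree[of w v] w v xyz
      by (simp add: X1.commute X2.commute)
  qed
  have 212: "d2 x z \<le> cross y x + cross y z" if xyz: "x \<in> X2" "y \<in> X1" "z \<in> X2" for x y z
  proof -
    obtain w where w: "w \<in> X1 \<inter> X2" "cross y x = d1 y w + d2 w x"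
      using cross_attained xyz by blast
    obtain v where v: "v \<in> X1 \<inter> X2" "cross y z = d1 y v + d2 v z"
      using cross_attained xyz by blast
    show ?thesis
      using X2.triangle[of x w z] X2.triangle[of w v z] X1.triangle[of w y v] agree[of w v] w v xyz
      by (simp add: X1.commute X2.commute)
  qed
  fix x y z assume xyz: "x \<in> X1 \<union> X2" "y \<in> X1 \<union> X2" "z \<in> X1 \<union> X2"
  consider "x \<in> X1" "y \<in> X1" "z \<in> X1" | "x \<in> X1" "y \<in> X1" "z \<in> X2"
    | "x \<in> X1" "y \<in> X2" "z \<in> X1" | "x \<in> X1" "y \<in> X2" "z \<in> X2"
    | "x \<in> X2" "y \<in> X1" "z \<in> X1" | "x \<in> X2" "y \<in> X1" "z \<in> X2"
    | "x \<in> X2" "y \<in> X2" "z \<in> X1" | "x \<in> X2" "y \<in> X2" "z \<in> X2"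
    using xyz by blast
  then show "glued_dist x z \<le> glued_dist x y + glued_dist y z"
  proof cases
    case 1 then show ?thesis using X1.triangle by (simp add: glued_dist_11)
  next
    case 2 then show ?thesis using 112 by (simp add: glued_dist_11 glued_dist_12)
  next
    case 3 then show ?thesis using 121 by (simp add: glued_dist_11 glued_dist_12 glued_dist_21)
  next
    case 4 then show ?thesis using 122 by (simp add: glued_dist_22 glued_dist_12)
  next
    case 5 then show ?thesis using 112[of z y x] by (simp add: glued_dist_11 glued_dist_21 X1.commute)
  next
    case 6 then show ?thesis using 212 by (simp add: glued_dist_22 glued_dist_12 glued_dist_21)
  next
    case 7 then show ?thesis using 122[of z y x] by (simp add: glued_dist_22 glued_dist_21 X2.commute)
  next
    case 8 then show ?thesis using X2.triangle by (simp add: glued_dist_22)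
  qed
qed

text \<open>The apex \<open>a\<close> lies in one piece and the geodesic from \<open>b\<close> to \<open>c\<close> in the other. The paths from \<open>a\<close> to \<open>b\<close>
  and to \<open>c\<close> pass through \<open>y\<close> and \<open>w\<close>. Triangle \<open>a w y\<close> in \<open>X2\<close> and triangle \<open>w c y\<close> in \<open>X1\<close> share the
  side \<open>w y\<close>; their union, a triangle \<open>a c y\<close>, shares the side \<open>y c\<close> with
  triangle \<open>y b c\<close>. So \<open>triangle_gluing\<close> applies twice. The points \<open>y\<close> and \<open>w\<close> are arbitrary, the paths
  through them need not be shortest.\<close>

lemma comparison_across:
  assumes p: "comparison_point X1 d1 b c t p" and bc: "b \<in> X1" "c \<in> X1" and a: "a \<in> X2"
    and t: "0 \<le> t" "t \<le> 1" and yw: "y \<in> X1 \<inter> X2" "w \<in> X1 \<inter> X2"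
  obtains z where "z \<in> X1 \<inter> X2"
    and "(d2 a z + d1 z p)\<^sup>2 \<le> (1 - t) * (d2 a y + d1 y b)\<^sup>2 + t * (d2 a w + d1 w c)\<^sup>2
      - t * (1 - t) * (d1 b c)\<^sup>2"
proof -
  note X = bc a yw[THEN IntD1] yw[THEN IntD2]
  have yw_eq: "d1 y w = d2 y w" "d1 w y = d2 w y"
    using agree yw by auto
  obtain r where r: "0 \<le> r" "r \<le> 1"
    and r_le: "\<And>\<alpha> \<beta> e m l.
      \<alpha>\<^sup>2 \<le> (1 - r) * (d2 a y)\<^sup>2 + r * m\<^sup>2 - r * (1 - r) * e\<^sup>2 \<Longrightarrow>
      \<beta>\<^sup>2 \<le> (1 - r)\<^sup>2 * e\<^sup>2 + (1 - t)\<^sup>2 * l\<^sup>2 - (1 - r) * (1 - t) * (e\<^sup>2 + l\<^sup>2 - (d1 y b)\<^sup>2) \<Longrightarrow>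
      0 \<le> e \<Longrightarrow> 0 \<le> l \<Longrightarrow> e \<le> d2 a y + m \<Longrightarrow> l \<le> e + d1 y b \<Longrightarrow>
      (\<alpha> + \<beta>)\<^sup>2 \<le> (1 - t) * (d2 a y + d1 y b)\<^sup>2 + t * m\<^sup>2 - t * (1 - t) * l\<^sup>2"
    using triangle_gluing[OF X2.nonneg[of a y] X1.nonneg[of y b] t] by blast
  obtain q where q: "comparison_point X1 d1 y c r q"
    using X1.ex_comparison_point X r by blast
  have r': "0 \<le> 1 - r" "1 - r \<le> 1" using r by auto
  obtain k where k: "0 \<le> k" "k \<le> 1"
    and k_le: "\<And>\<alpha> \<beta> e m l.
      \<alpha>\<^sup>2 \<le> (1 - k) * (d2 a w)\<^sup>2 + k * m\<^sup>2 - k * (1 - k) * e\<^sup>2 \<Longrightarrow>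
      \<beta>\<^sup>2 \<le> (1 - k)\<^sup>2 * e\<^sup>2 + (1 - (1 - r))\<^sup>2 * l\<^sup>2 - (1 - k) * (1 - (1 - r)) * (e\<^sup>2 + l\<^sup>2 - (d1 w c)\<^sup>2) \<Longrightarrow>
      0 \<le> e \<Longrightarrow> 0 \<le> l \<Longrightarrow> e \<le> d2 a w + m \<Longrightarrow> l \<le> e + d1 w c \<Longrightarrow>
      (\<alpha> + \<beta>)\<^sup>2 \<le> (1 - (1 - r)) * (d2 a w + d1 w c)\<^sup>2 + (1 - r) * m\<^sup>2 - (1 - r) * (1 - (1 - r)) * l\<^sup>2"
    using triangle_gluing[OF X2.nonneg[of a w] X1.nonneg[of w c] r'] by blast
  obtain z where z: "comparison_point X1 d1 w y k z" "comparison_point X2 d2 w y k z"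
    using convex_overlap yw k by blast
  have zA: "z \<in> X1 \<inter> X2" using z by (auto dest: comparison_pointD)
  have qp: "q \<in> X1" "p \<in> X1" using q p by (auto dest: comparison_pointD)
  have "(d2 a z + d1 z q)\<^sup>2 \<le> (1 - (1 - r)) * (d2 a w + d1 w c)\<^sup>2 + (1 - r) * (d2 a y)\<^sup>2
      - (1 - r) * (1 - (1 - r)) * (d1 c y)\<^sup>2"
  proof (rule k_le)
    show "(d2 a z)\<^sup>2 \<le> (1 - k) * (d2 a w)\<^sup>2 + k * (d2 a y)\<^sup>2 - k * (1 - k) * (d1 w y)\<^sup>2"
      using comparison_pointD(2)[OF z(2)] a by (simp add: yw_eq)
    show "(d1 z q)\<^sup>2 \<le> (1 - k)\<^sup>2 * (d1 w y)\<^sup>2 + (1 - (1 - r))\<^sup>2 * (d1 c y)\<^sup>2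
        - (1 - k) * (1 - (1 - r)) * ((d1 w y)\<^sup>2 + (d1 c y)\<^sup>2 - (d1 w c)\<^sup>2)"
      using X r k by (intro X1.comparison_point_hinge[OF X1.comparison_point_swap[OF q] z(1)]) auto
    show "d1 w y \<le> d2 a w + d2 a y"
      using X2.triangle[of w a y] X by (simp add: yw_eq X2.commute)
    show "d1 c y \<le> d1 w y + d1 w c"
      using X1.triangle[of c w y] X by (simp add: X1.commute)
  qed auto
  then have "(d2 a z + d1 z q)\<^sup>2 \<le> (1 - r) * (d2 a y)\<^sup>2 + r * (d2 a w + d1 w c)\<^sup>2 - r * (1 - r) * (d1 y c)\<^sup>2"
    by (simp add: X1.commute algebra_simps)
  then have "(d2 a z + d1 z q + d1 q p)\<^sup>2
      \<le> (1 - t) * (d2 a y + d1 y b)\<^sup>2 + t * (d2 a w + d1 w c)\<^sup>2 - t * (1 - t) * (d1 b c)\<^sup>2"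
  proof (rule r_le)
    show "(d1 q p)\<^sup>2 \<le> (1 - r)\<^sup>2 * (d1 y c)\<^sup>2 + (1 - t)\<^sup>2 * (d1 b c)\<^sup>2
        - (1 - r) * (1 - t) * ((d1 y c)\<^sup>2 + (d1 b c)\<^sup>2 - (d1 y b)\<^sup>2)"
      using X r t by (intro X1.comparison_point_hinge[OF p q]) auto
    show "d1 y c \<le> d2 a y + (d2 a w + d1 w c)"
      using X1.triangle[of y w c] X2.triangle[of y a w] X by (simp add: yw_eq X2.commute)
    show "d1 b c \<le> d1 y c + d1 y b"
      using X1.triangle[of b y c] X by (simp add: X1.commute)
  qed auto
  moreover have "(d2 a z + d1 z p)\<^sup>2 \<le> (d2 a z + d1 z q + d1 q p)\<^sup>2"
    using X1.triangle[of z q p] zA qp by (intro power_mono) auto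
  ultimately have "(d2 a z + d1 z p)\<^sup>2 \<le> (1 - t) * (d2 a y + d1 y b)\<^sup>2 + t * (d2 a w + d1 w c)\<^sup>2
      - t * (1 - t) * (d1 b c)\<^sup>2"
    by linarith
  with zA show ?thesis
    by (rule that)
qed

lemma comparison_point_1:
  assumes p: "comparison_point X1 d1 b c t p" and bc: "b \<in> X1" "c \<in> X1" and t: "0 \<le> t" "t \<le> 1"
  shows "comparison_point (X1 \<union> X2) glued_dist b c t p"
  unfolding comparison_point_def
proof (intro conjI ballI)
  have pX: "p \<in> X1" using p by (rule comparison_pointD)
  then show "p \<in> X1 \<union> X2" by simp
  fix a assume "a \<in> X1 \<union> X2"
  then consider "a \<in> X1" | "a \<in> X2" by blast
  then show "(glued_dist a p)\<^sup>2 \<le> (1 - t) * (glued_dist a b)\<^sup>2 + t * (glued_dist a c)\<^sup>2 - t * (1 - t) * (glued_dist b c)\<^sup>2"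
  proof cases
    case 1
    then show ?thesis using comparison_pointD(2)[OF p] bc pX by (simp add: glued_dist_11)
  next
    case 2
    obtain y where y: "y \<in> X1 \<inter> X2" "cross b a = d1 b y + d2 y a"
      using cross_attained bc 2 by blast
    obtain w where w: "w \<in> X1 \<inter> X2" "cross c a = d1 c w + d2 w a"
      using cross_attained bc 2 by blast
    obtain z where z: "z \<in> X1 \<inter> X2"
      and le: "(d2 a z + d1 z p)\<^sup>2 \<le> (1 - t) * (d2 a y + d1 y b)\<^sup>2 + t * (d2 a w + d1 w c)\<^sup>2
        - t * (1 - t) * (d1 b c)\<^sup>2"
      using comparison_across[OF p bc 2 t y(1) w(1)] by blast
    have "(cross p a)\<^sup>2 \<le> (d2 a z + d1 z p)\<^sup>2"
      using cross_le[OF z, of p a] cross_nonneg[OF pX 2]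
      by (intro power_mono) (auto simp: X1.commute X2.commute)
    then show ?thesis
      using le 2 bc pX y w
      by (simp add: glued_dist_11 glued_dist_21 X1.commute[of y b] X1.commute[of w c] X2.commute[of a] add.commute)
  qed
qed

lemma comparison_point_2:
  assumes p: "comparison_point X2 d2 b c t p" and bc: "b \<in> X2" "c \<in> X2" and t: "0 \<le> t" "t \<le> 1"
  shows "comparison_point (X1 \<union> X2) glued_dist b c t p"
proof -
  interpret S: gluing X2 d2 X1 d1 by (rule swap)
  have cross: "S.cross y x = cross x y" if "x \<in> X1" "y \<in> X2" for x y
    unfolding S.cross_def cross_def
    by (simp add: X1.commute[of _ x] X2.commute[of y] Int_commute add.commute)
  have S_eq: "S.glued_dist x y = glued_dist x y" if "x \<in> X1 \<union> X2" "y \<in> X1 \<union> X2" for x y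
    using that cross[of x y] cross[of y x]
    by (elim UnE) (simp_all add: glued_dist_11 glued_dist_22 glued_dist_12 glued_dist_21 S.glued_dist_11 S.glued_dist_22 S.glued_dist_12 S.glued_dist_21)
  have S: "comparison_point (X1 \<union> X2) S.glued_dist b c t p"
    using S.comparison_point_1[OF assms] by (simp add: Un_commute)
  show ?thesis
    unfolding comparison_point_def
  proof (intro conjI ballI)
    show pX: "p \<in> X1 \<union> X2"
      using S by (rule comparison_pointD)
    fix a assume "a \<in> X1 \<union> X2"
    then show "(glued_dist a p)\<^sup>2 \<le> (1 - t) * (glued_dist a b)\<^sup>2 + t * (glued_dist a c)\<^sup>2 - t * (1 - t) * (glued_dist b c)\<^sup>2"
      using comparison_pointD(2)[OF S] pX bc S_eq by simp
  qed
qed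

text \<open>The crossing point of a shortest connection is a comparison point, and the two parts on either side
  of it lie in one piece each, where comparison points are available.\<close>

lemma ex_comparison_point_across:
  assumes b: "b \<in> X1" and c: "c \<in> X2" and t: "0 \<le> t" "t \<le> 1"
  shows "\<exists>p. comparison_point (X1 \<union> X2) glued_dist b c t p"
proof -
  obtain z where z: "z \<in> X1 \<inter> X2" "cross b c = d1 b z + d2 z c"
    using cross_attained b c by blast
  have in_piece: "\<exists>p. comparison_point (X1 \<union> X2) glued_dist u v s p"
    if "u \<in> X1 \<and> v \<in> X1 \<or> u \<in> X2 \<and> v \<in> X2" "0 \<le> s" "s \<le> 1" for u v s
    using that X1.ex_comparison_point[of u v s] X2.ex_comparison_point[of u v s]
      comparison_point_1[of u v s] comparison_point_2[of u v s] by blast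
  show ?thesis
  proof (cases "z = b \<or> z = c")
    case True
    then show ?thesis using in_piece[of b c t] z b c t by blast
  next
    case False
    have X: "b \<in> X1 \<union> X2" "c \<in> X1 \<union> X2" "z \<in> X1 \<union> X2" using b c z by auto
    have len: "glued_dist b c = glued_dist b z + glued_dist z c"
      using z b c glued_dist_12[of b c] glued_dist_11[of b z] glued_dist_22[of z c] by simp
    have pos: "0 < glued_dist b z" "0 < glued_dist z c"
      using False X glued.mdist_pos_eq by auto
    define s where "s = glued_dist b z / glued_dist b c"
    have s: "0 < s" "s < 1" using pos len by (auto simp: s_def)
    have cz: "comparison_point (X1 \<union> X2) glued_dist b c s z"
      unfolding s_def using X len pos
      by (rule glued.comparison_point_crossing) (use in_piece z in blast)
    show ?thesis
    proof (cases "t \<le> s")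
      case True
      then obtain p where "comparison_point (X1 \<union> X2) glued_dist b z (t / s) p"
        using in_piece[of b z "t / s"] b z s t by auto
      then have "comparison_point (X1 \<union> X2) glued_dist b c (t / s * s) p"
        using X s t True by (intro glued.comparison_point_concat[OF cz]) auto
      then show ?thesis using s by auto
    next
      case False
      then obtain p where "comparison_point (X1 \<union> X2) glued_dist c z ((1 - t) / (1 - s)) p"
        using in_piece[of c z "(1 - t) / (1 - s)"] c z s t by auto
      then have "comparison_point (X1 \<union> X2) glued_dist c b ((1 - t) / (1 - s) * (1 - s)) p"
        using X s t False
        by (intro glued.comparison_point_concat[OF glued.comparison_point_swap[OF cz]]) auto
      then have "comparison_point (X1 \<union> X2) glued_dist c b (1 - t) p"
        using s by simp
      from glued.comparison_point_swap[OF this] show ?thesis by auto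
    qed
  qed
qed

text \<open>Reshetnyak's gluing theorem.\<close>

theorem glued_cat0: "cat0 (X1 \<union> X2) glued_dist"
proof
  fix b c t assume bc: "b \<in> X1 \<union> X2" "c \<in> X1 \<union> X2" and t: "0 \<le> t" "t \<le> (1::real)"
  then consider "b \<in> X1" "c \<in> X1" | "b \<in> X2" "c \<in> X2" | "b \<in> X1" "c \<in> X2" | "b \<in> X2" "c \<in> X1"
    by blast
  then show "\<exists>p. comparison_point (X1 \<union> X2) glued_dist b c t p"
  proof cases
    case 1 then show ?thesis
      using X1.ex_comparison_point[of b c t] comparison_point_1[of b c t] t by blast
  next
    case 2 then show ?thesis
      using X2.ex_comparison_point[of b c t] comparison_point_2[of b c t] t by blast
  next
    case 3 then show ?thesis using ex_comparison_point_across t by blast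
  next
    case 4
    then obtain p where "comparison_point (X1 \<union> X2) glued_dist c b (1 - t) p"
      using ex_comparison_point_across[of c b "1 - t"] t by auto
    from glued.comparison_point_swap[OF this] show ?thesis by auto
  qed
qed

end

section \<open>Length distances\<close>

lemma (in Metric_space) pathin_mtopology_iff:
  "pathin mtopology g \<longleftrightarrow> g ` {0..1} \<subseteq> M \<and>
     (\<forall>s\<in>{0..1}. \<forall>\<epsilon>>0. \<exists>\<delta>>0. \<forall>t\<in>{0..1}. \<bar>t - s\<bar> < \<delta> \<longrightarrow> d (g s) (g t) < \<epsilon>)"
proof (intro iffI conjI ballI allI impI)
  assume g: "pathin mtopology g"
  then show img: "g ` {0..1} \<subseteq> M"
    using continuous_map_image_subset_topspace by (fastforce simp: pathin_def)
  fix s :: real and \<epsilon> :: real assume s: "s \<in> {0..1}" "0 < \<epsilon>"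
  then obtain U where U: "openin (top_of_set {0..1}) U" "s \<in> U" "\<And>t. t \<in> U \<Longrightarrow> g t \<in> mball (g s) \<epsilon>"
    using g unfolding pathin_def continuous_map_to_metric topspace_euclidean_subtopology by metis
  then obtain \<delta> where "0 < \<delta>" "\<And>t. t \<in> {0..1} \<Longrightarrow> dist t s < \<delta> \<Longrightarrow> t \<in> U"
    unfolding openin_euclidean_subtopology_iff by meson
  then show "\<exists>\<delta>>0. \<forall>t\<in>{0..1}. \<bar>t - s\<bar> < \<delta> \<longrightarrow> d (g s) (g t) < \<epsilon>"
    using U(3) by (auto simp: dist_real_def)
next
  assume g: "g ` {0..1} \<subseteq> M \<and>
     (\<forall>s\<in>{0..1}. \<forall>\<epsilon>>0. \<exists>\<delta>>0. \<forall>t\<in>{0..1}. \<bar>t - s\<bar> < \<delta> \<longrightarrow> d (g s) (g t) < \<epsilon>)"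
  show "pathin mtopology g"
    unfolding pathin_def continuous_map_to_metric
  proof (intro ballI allI impI)
    fix s \<epsilon> :: real assume "s \<in> topspace (top_of_set {0..1})" and \<epsilon>: "0 < \<epsilon>"
    then have s: "s \<in> {0..1}" by simp
    then obtain \<delta> where \<delta>: "0 < \<delta>" "\<And>t. t \<in> {0..1} \<Longrightarrow> \<bar>t - s\<bar> < \<delta> \<Longrightarrow> d (g s) (g t) < \<epsilon>"
      using g \<epsilon> by meson
    show "\<exists>U. openin (top_of_set {0..1}) U \<and> s \<in> U \<and> (\<forall>y\<in>U. g y \<in> mball (g s) \<epsilon>)"
    proof (intro exI conjI ballI)
      show "openin (top_of_set {0..1}) ({0..1} \<inter> ball s \<delta>)"
        by (simp add: openin_open_Int)
      show "s \<in> {0..1} \<inter> ball s \<delta>" using s \<delta> by simp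
      show "g t \<in> mball (g s) \<epsilon>" if "t \<in> {0..1} \<inter> ball s \<delta>" for t
        using that s g \<delta>(2)[of t] by (auto simp: dist_real_def abs_minus_commute image_subset_iff)
    qed
  qed
qed

lemma curve_length_upper:
  assumes "sorted ts" "set ts \<subseteq> {0..1}"
  shows "ereal (\<Sum>i<length ts - 1. d (g (ts ! i)) (g (ts ! Suc i))) \<le> curve_length d g"
  unfolding curve_length_def by (rule SUP_upper) (use assms in auto)

lemma curve_length_nonneg: "0 \<le> curve_length d g"
  using curve_length_upper[of "[]" d g] by (simp add: zero_ereal_def)

lemma length_dist_outside:
  assumes "Metric_space S e" "x \<notin> S \<or> y \<notin> S"
  shows "length_dist S e x y = 0"
proof -
  have none: "{g. pathin (Metric_space.mtopology S e) g \<and> g 0 = x \<and> g 1 = y} = {}"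
    using assms Metric_space.pathin_mtopology_iff[OF assms(1)] by (auto simp: image_subset_iff)
  show ?thesis unfolding length_dist_def none by (simp add: top_ereal_def)
qed

lemma length_dist_nonneg: "0 \<le> length_dist S e x y"
  unfolding length_dist_def
  by (intro real_of_ereal_pos INF_greatest curve_length_nonneg)

lemma curve_length_lipschitz:
  assumes "0 \<le> L" and lip: "\<And>s t. s \<in> {0..1} \<Longrightarrow> t \<in> {0..1} \<Longrightarrow> s \<le> t \<Longrightarrow> d (g s) (g t) \<le> L * (t - s)"
  shows "curve_length d g \<le> ereal L"
  unfolding curve_length_def
proof (rule SUP_least, safe)
  fix ts :: "real list" assume ts: "sorted ts" "set ts \<subseteq> {0..1}"
  show "ereal (\<Sum>i<length ts - 1. d (g (ts ! i)) (g (ts ! Suc i))) \<le> ereal L"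
  proof (cases "ts = []")
    case True
    then show ?thesis using assms by simp
  next
    case False
    then have in01: "ts ! i \<in> {0..1}" if "i < length ts" for i
      using ts nth_mem that by blast
    have "(\<Sum>i<length ts - 1. d (g (ts ! i)) (g (ts ! Suc i))) \<le> (\<Sum>i<length ts - 1. L * (ts ! Suc i - ts ! i))"
      using ts in01 by (intro sum_mono lip) (auto simp: sorted_nth_mono)
    also have "\<dots> = L * (ts ! (length ts - 1) - ts ! 0)"
      by (simp add: sum_distrib_left[symmetric] sum_lessThan_telescope)
    also have "\<dots> \<le> L * 1"
      using assms in01[of 0] in01[of "length ts - 1"] False by (intro mult_left_mono) auto
    finally show ?thesis by simp
  qed
qed

text \<open>By the local assumption and continuity, every parameter \<open>x\<close> has a neighbourhood such that the triangle
  inequality of \<open>d\<close> through \<open>g x\<close> bounds \<open>d\<close> by the \<open>e\<close>-length of a two-step chain. Bolzano's bisection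
  principle joins these chains to one over the whole interval. The local assumption is only about the
  distance from the fixed point \<open>x\<close>: it does not say that \<open>d\<close> and \<open>e\<close> agree on a neighbourhood, which
  fails near the apex of a cone.\<close>

lemma dist_le_curve_length:
  fixes g :: "real \<Rightarrow> 'a"
  assumes S: "Metric_space S e" and T: "Metric_space S d"
    and local: "\<And>x. x \<in> S \<Longrightarrow> \<exists>\<delta>>0. \<forall>y\<in>S. e x y < \<delta> \<longrightarrow> d x y = e x y"
    and g: "pathin (Metric_space.mtopology S e) g"
  shows "ereal (d (g 0) (g 1)) \<le> curve_length e g"
proof -
  interpret e: Metric_space S e by fact
  interpret d: Metric_space S d by fact
  have gS: "g t \<in> S" if "0 \<le> t" "t \<le> 1" for t
    using g that by (auto simp: e.pathin_mtopology_iff image_subset_iff)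
  \<comment> \<open>The chain is \<open>a # ts @ [b]\<close>, so that both end points are visible in its shape.\<close>
  define P where "P a b \<longleftrightarrow> (0 \<le> a \<longrightarrow> a \<le> b \<longrightarrow> b \<le> 1 \<longrightarrow>
    (\<exists>ts. sorted (a # ts @ [b]) \<and>
      d (g a) (g b) \<le> (\<Sum>i<Suc (length ts). e (g ((a # ts @ [b]) ! i)) (g ((a # ts @ [b]) ! Suc i)))))" for a b
  have sum_split: "(\<Sum>i<m + n. f i) = (\<Sum>i<m. f i) + (\<Sum>i<n. f (m + i))" for f :: "nat \<Rightarrow> real" and m n
    by (induction n) (simp_all add: add.assoc)
  have "(0::real) \<le> 1" by simp
  then have "P 0 1"
  proof (induct rule: Bolzano)
    case (trans a b c)
    show ?case
      unfolding P_def
    proof (intro impI)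
      assume abc: "0 \<le> a" "a \<le> c" "c \<le> 1"
      obtain us where us: "sorted (a # us @ [b])"
        "d (g a) (g b) \<le> (\<Sum>i<Suc (length us). e (g ((a # us @ [b]) ! i)) (g ((a # us @ [b]) ! Suc i)))"
        using trans abc unfolding P_def by auto
      obtain vs where vs: "sorted (b # vs @ [c])"
        "d (g b) (g c) \<le> (\<Sum>i<Suc (length vs). e (g ((b # vs @ [c]) ! i)) (g ((b # vs @ [c]) ! Suc i)))"
        using trans abc unfolding P_def by auto
      let ?ts = "us @ b # vs"
      let ?f = "\<lambda>i. e (g ((a # ?ts @ [c]) ! i)) (g ((a # ?ts @ [c]) ! Suc i))"
      have "sorted (a # ?ts @ [c])"
        using us(1) vs(1) trans(3,4) by (fastforce simp: sorted_append)
      moreover have "(\<Sum>i<Suc (length ?ts). ?f i) = (\<Sum>i<Suc (length us). ?f i) + (\<Sum>i<Suc (length vs). ?f (Suc (length us) + i))"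
        using sum_split[of ?f "Suc (length us)" "Suc (length vs)"] by simp
      moreover have "(\<Sum>i<Suc (length us). ?f i) = (\<Sum>i<Suc (length us). e (g ((a # us @ [b]) ! i)) (g ((a # us @ [b]) ! Suc i)))"
        by (rule sum.cong) (auto simp: nth_append nth_Cons split: nat.split)
      moreover have "(\<Sum>i<Suc (length vs). ?f (Suc (length us) + i)) = (\<Sum>i<Suc (length vs). e (g ((b # vs @ [c]) ! i)) (g ((b # vs @ [c]) ! Suc i)))"
        by (rule sum.cong) (auto simp: nth_append nth_Cons split: nat.split)
      moreover have "d (g a) (g c) \<le> d (g a) (g b) + d (g b) (g c)"
        using trans abc by (intro d.triangle gS) auto
      ultimately show "\<exists>ts. sorted (a # ts @ [c]) \<and>
          d (g a) (g c) \<le> (\<Sum>i<Suc (length ts). e (g ((a # ts @ [c]) ! i)) (g ((a # ts @ [c]) ! Suc i)))"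
        using us(2) vs(2) by (intro exI[of _ ?ts]) linarith
    qed
  next
    case (local x)
    then have x: "x \<in> {0..1}" "g x \<in> S" using gS by auto
    then obtain \<epsilon> where \<epsilon>: "0 < \<epsilon>" "\<And>y. y \<in> S \<Longrightarrow> e (g x) y < \<epsilon> \<Longrightarrow> d (g x) y = e (g x) y"
      using assms(3) by blast
    then obtain \<delta> where \<delta>: "0 < \<delta>" "\<And>t. t \<in> {0..1} \<Longrightarrow> \<bar>t - x\<bar> < \<delta> \<Longrightarrow> e (g x) (g t) < \<epsilon>"
      using g x unfolding e.pathin_mtopology_iff by meson
    show ?case
    proof (intro exI conjI allI impI)
      show "0 < \<delta>" by fact
      fix a b assume ab: "a \<le> x \<and> x \<le> b \<and> b - a < \<delta>"
      show "P a b"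
        unfolding P_def
      proof (intro impI exI conjI)
        assume 01: "0 \<le> a" "a \<le> b" "b \<le> 1"
        show "sorted (a # [x] @ [b])" using ab by simp
        have "d (g x) (g a) = e (g x) (g a)" "d (g x) (g b) = e (g x) (g b)"
          using ab 01 by (auto intro!: \<epsilon>(2) \<delta>(2) gS)
        then show "d (g a) (g b) \<le> (\<Sum>i<Suc (length [x]). e (g ((a # [x] @ [b]) ! i)) (g ((a # [x] @ [b]) ! Suc i)))"
          using d.triangle[of "g a" "g x" "g b"] gS[of a] gS[of b] x ab 01
          by (simp add: d.commute[of "g a"] e.commute[of "g a"])
      qed
    qed
  qed
  then obtain ts where ts: "sorted (0 # ts @ [1])"
    "d (g 0) (g 1) \<le> (\<Sum>i<Suc (length ts). e (g ((0 # ts @ [1]) ! i)) (g ((0 # ts @ [1]) ! Suc i)))"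
    unfolding P_def by auto
  then have "ereal (d (g 0) (g 1)) \<le> ereal (\<Sum>i<length (0 # ts @ [1]) - 1. e (g ((0 # ts @ [1]) ! i)) (g ((0 # ts @ [1]) ! Suc i)))"
    by simp
  also have "\<dots> \<le> curve_length e g"
    using ts(1) by (intro curve_length_upper) (auto simp: sorted_append)
  finally show ?thesis .
qed

lemma length_dist_eq:
  assumes S: "Metric_space S e" and T: "Metric_space S d"
    and le: "\<And>x y. x \<in> S \<Longrightarrow> y \<in> S \<Longrightarrow> e x y \<le> d x y"
    and local: "\<And>x. x \<in> S \<Longrightarrow> \<exists>\<delta>>0. \<forall>y\<in>S. e x y < \<delta> \<longrightarrow> d x y = e x y"
    and geo: "\<exists>\<gamma>. geodesic S d \<gamma> x y" and xy: "x \<in> S" "y \<in> S"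
  shows "length_dist S e x y = d x y"
proof -
  interpret e: Metric_space S e by fact
  interpret d: Metric_space S d by fact
  obtain \<gamma> where \<gamma>: "geodesic S d \<gamma> x y" using geo by blast
  define L where "L = d x y"
  define g where "g = (\<lambda>t. \<gamma> (L * t))"
  have L: "0 \<le> L" by (simp add: L_def)
  have dom: "L * t \<in> {0..d x y}" if "t \<in> {0..1}" for t
    using that L mult_left_le[of t L] by (auto simp: L_def)
  have gS: "g t \<in> S" if "t \<in> {0..1}" for t
    using \<gamma> dom[OF that] unfolding geodesic_def g_def by blast
  have lip: "e (g s) (g t) \<le> L * \<bar>t - s\<bar>" if "s \<in> {0..1}" "t \<in> {0..1}" for s t
  proof -
    have "e (g s) (g t) \<le> d (g s) (g t)" using le gS that by blast
    also have "\<dots> = \<bar>L * s - L * t\<bar>"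
      using \<gamma> dom that unfolding geodesic_def g_def by blast
    also have "\<dots> = L * \<bar>t - s\<bar>"
      using L by (simp add: right_diff_distrib[symmetric] abs_mult abs_minus_commute)
    finally show ?thesis .
  qed
  have path: "pathin e.mtopology g"
    unfolding e.pathin_mtopology_iff
  proof (intro conjI ballI allI impI)
    show "g ` {0..1} \<subseteq> S" using gS by blast
    fix s \<epsilon> :: real assume s: "s \<in> {0..1}" and \<epsilon>: "0 < \<epsilon>"
    show "\<exists>\<delta>>0. \<forall>t\<in>{0..1}. \<bar>t - s\<bar> < \<delta> \<longrightarrow> e (g s) (g t) < \<epsilon>"
    proof (intro exI conjI ballI impI)
      show "0 < \<epsilon> / (L + 1)" using L \<epsilon> by simp
      fix t :: real assume t: "t \<in> {0..1}" "\<bar>t - s\<bar> < \<epsilon> / (L + 1)"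
      have "L * \<bar>t - s\<bar> \<le> (L + 1) * \<bar>t - s\<bar>" by (simp add: distrib_right)
      also have "\<dots> < \<epsilon>" using t L by (simp add: pos_less_divide_eq mult.commute)
      finally show "e (g s) (g t) < \<epsilon>" using lip[OF s t(1)] by linarith
    qed
  qed
  have "curve_length e g \<le> ereal L"
  proof (rule curve_length_lipschitz[OF L])
    show "e (g s) (g t) \<le> L * (t - s)" if "s \<in> {0..1}" "t \<in> {0..1}" "s \<le> t" for s t
      using lip[OF that(1,2)] that(3) by simp
  qed
  moreover have "g 0 = x" "g 1 = y"
    using \<gamma> by (auto simp: g_def geodesic_def L_def)
  ultimately have "(INF g \<in> {g. pathin e.mtopology g \<and> g 0 = x \<and> g 1 = y}. curve_length e g) \<le> ereal L"
    using path by (intro INF_lower2[of g]) auto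
  moreover have "ereal L \<le> (INF g \<in> {g. pathin e.mtopology g \<and> g 0 = x \<and> g 1 = y}. curve_length e g)"
    using dist_le_curve_length[OF S T local] unfolding L_def by (intro INF_greatest) auto
  ultimately have "(INF g \<in> {g. pathin e.mtopology g \<and> g 0 = x \<and> g 1 = y}. curve_length e g) = ereal L"
    by (rule antisym)
  then show ?thesis unfolding length_dist_def by (simp add: L_def)
qed

section \<open>Spaces of orthants\<close>

definition orthant_space :: "('v \<Rightarrow> 'v \<Rightarrow> bool) \<Rightarrow> 'v set \<Rightarrow> ('v \<Rightarrow> real) set" where
  "orthant_space R V =
     {x. (\<forall>u. u \<notin> V \<longrightarrow> x u = 0) \<and> (\<forall>u. 0 \<le> x u) \<and> (\<forall>u w. 0 < x u \<longrightarrow> 0 < x w \<longrightarrow> R u w)}"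

definition share_orthant :: "('v \<Rightarrow> 'v \<Rightarrow> bool) \<Rightarrow> ('v \<Rightarrow> real) \<Rightarrow> ('v \<Rightarrow> real) \<Rightarrow> bool" where
  "share_orthant R x y \<longleftrightarrow> (\<forall>u w. 0 < x u \<or> 0 < y u \<longrightarrow> 0 < x w \<or> 0 < y w \<longrightarrow> R u w)"

definition euclid :: "'v set \<Rightarrow> ('v \<Rightarrow> real) \<Rightarrow> ('v \<Rightarrow> real) \<Rightarrow> real" where
  "euclid V x y = L2_set (\<lambda>u. x u - y u) V"

lemma orthant_spaceD:
  assumes "x \<in> orthant_space R V"
  shows "u \<notin> V \<Longrightarrow> x u = 0" "0 \<le> x u" "0 < x u \<Longrightarrow> 0 < x w \<Longrightarrow> R u w"
  using assms by (auto simp: orthant_space_def)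

lemma zero_coordinate_mem: "x \<in> orthant_space R V \<Longrightarrow> x(u := 0) \<in> orthant_space R V"
  by (auto simp: orthant_space_def split: if_splits)

lemma euclid_nonneg: "0 \<le> euclid V x y"
  by (simp add: euclid_def)

lemma euclid_commute: "euclid V x y = euclid V y x"
  by (simp add: euclid_def L2_set_def power2_commute)

lemma euclid_triangle: "euclid V x z \<le> euclid V x y + euclid V y z"
  using L2_set_triangle_ineq[of "\<lambda>u. x u - y u" "\<lambda>u. y u - z u" V] by (simp add: euclid_def)

lemma Metric_space_euclid:
  assumes "finite V" and S: "\<And>x u. x \<in> S \<Longrightarrow> u \<notin> V \<Longrightarrow> x u = 0"
  shows "Metric_space S (euclid V)"
proof
  fix x y assume "x \<in> S" "y \<in> S"
  then show "euclid V x y = 0 \<longleftrightarrow> x = y"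
    using S[of x] S[of y] assms(1) by (fastforce simp: euclid_def L2_set_eq_0_iff fun_eq_iff)
qed (auto simp: euclid_nonneg euclid_commute euclid_triangle)

lemma coordinate_le_euclid:
  assumes "finite V" "u \<in> V"
  shows "\<bar>x u - y u\<bar> \<le> euclid V x y"
  using member_le_L2_set[OF assms, of "\<lambda>u. \<bar>x u - y u\<bar>"] by (simp add: euclid_def L2_set_def)

lemma euclid_insert:
  assumes "finite W" "v \<notin> W"
  shows "euclid (insert v W) x y = sqrt ((euclid W (x(v := 0)) (y(v := 0)))\<^sup>2 + (x v - y v)\<^sup>2)"
proof -
  have "L2_set (\<lambda>u. x u - y u) W = L2_set (\<lambda>u. (x(v := 0)) u - (y(v := 0)) u) W"
    by (rule L2_set_cong) (use assms in auto)
  then show ?thesis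
    using assms by (simp add: euclid_def L2_set_insert add.commute)
qed

lemma euclid_zero_coordinate:
  assumes "finite V" "u \<in> V"
  shows "euclid V x (x(u := 0)) = \<bar>x u\<bar>"
proof -
  have "(\<Sum>w\<in>V. (x w - (x(u := 0)) w)\<^sup>2) = (\<Sum>w\<in>V. if w = u then (x u)\<^sup>2 else 0)"
    by (rule sum.cong) auto
  then show ?thesis using assms by (simp add: euclid_def L2_set_def)
qed

text \<open>Coordinates that are positive at \<open>x\<close> stay positive nearby, so the orthant of a nearby point also
  contains \<open>x\<close>.\<close>

lemma near_shares_orthant:
  assumes "finite V" and x: "x \<in> orthant_space R V"
  obtains \<delta> where "0 < \<delta>" "\<And>y. y \<in> orthant_space R V \<Longrightarrow> euclid V x y < \<delta> \<Longrightarrow> share_orthant R x y"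
proof -
  define \<delta> where "\<delta> = Min (insert 1 (x ` {u \<in> V. 0 < x u}))"
  have fin: "finite (insert 1 (x ` {u \<in> V. 0 < x u}))" using assms by simp
  have pos: "0 < \<delta>" unfolding \<delta>_def using fin by (subst Min_gr_iff) auto
  have "share_orthant R x y" if y: "y \<in> orthant_space R V" "euclid V x y < \<delta>" for y
  proof -
    have "0 < y u" if u: "0 < x u" for u
    proof -
      have "u \<in> V" using u orthant_spaceD(1)[OF x, of u] by (cases "u \<in> V") auto
      then have "\<delta> \<le> x u" unfolding \<delta>_def using fin u by (intro Min_le) auto
      then show ?thesis
        using coordinate_le_euclid[OF assms(1) \<open>u \<in> V\<close>, of x y] y by linarith
    qed
    then show ?thesis
      using orthant_spaceD(3)[OF y(1)] unfolding share_orthant_def by blast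
  qed
  then show ?thesis using that pos by blast
qed

lemma share_orthant_zero_coordinate:
  assumes "x \<in> orthant_space R V"
  shows "share_orthant R x (x(u := 0))"
  using orthant_spaceD(3)[OF assms] by (auto simp: share_orthant_def split: if_splits)

text \<open>The properties of the length metric that the induction carries along. They are chosen such that the
  metric itself need not be computed; \<open>length_dist_eq\<close> shows that they leave only one possibility.\<close>

locale orthant_metric = cat0 "orthant_space R V" d for R :: "'v \<Rightarrow> 'v \<Rightarrow> bool" and V d +
  assumes finite_V: "finite V"
    and flat: "x \<in> orthant_space R V \<Longrightarrow> y \<in> orthant_space R V \<Longrightarrow> share_orthant R x y \<Longrightarrow> d x y = euclid V x y"
    and euclid_le: "x \<in> orthant_space R V \<Longrightarrow> y \<in> orthant_space R V \<Longrightarrow> euclid V x y \<le> d x y"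
    and retract: "x \<in> orthant_space R V \<Longrightarrow> y \<in> orthant_space R V \<Longrightarrow> d (x(u := 0)) (y(u := 0)) \<le> d x y"
begin

lemma locally_euclid:
  assumes "x \<in> orthant_space R V"
  shows "\<exists>\<delta>>0. \<forall>y\<in>orthant_space R V. euclid V x y < \<delta> \<longrightarrow> d x y = euclid V x y"
proof -
  obtain \<delta> where "0 < \<delta>" "\<And>y. y \<in> orthant_space R V \<Longrightarrow> euclid V x y < \<delta> \<Longrightarrow> share_orthant R x y"
    using near_shares_orthant[OF finite_V assms] by blast
  then show ?thesis using flat assms by blast
qed

lemma dist_zero_coordinate:
  assumes "x \<in> orthant_space R V"
  shows "d x (x(u := 0)) = x u"
proof (cases "u \<in> V")
  case True
  have "d x (x(u := 0)) = euclid V x (x(u := 0))"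
    using assms by (intro flat zero_coordinate_mem share_orthant_zero_coordinate)
  then show ?thesis
    using euclid_zero_coordinate[OF finite_V True, of x] orthant_spaceD(2)[OF assms, of u] by simp
next
  case False
  then have "x u = 0" by (rule orthant_spaceD(1)[OF assms])
  then show ?thesis using assms by (simp add: fun_upd_idem)
qed

lemma coordinate_le_dist:
  assumes "x \<in> orthant_space R V" "y \<in> orthant_space R V"
  shows "\<bar>x u - y u\<bar> \<le> d x y"
proof (cases "u \<in> V")
  case True
  then show ?thesis
    using coordinate_le_euclid[OF finite_V True, of x y] euclid_le[OF assms] by linarith
next
  case False
  then show ?thesis using assms[THEN orthant_spaceD(1)] by simp
qed

text \<open>The coordinate \<open>x u\<close> is the distance from \<open>x\<close> to the set where that coordinate vanishes. This set is
  convex because setting the coordinate to zero retracts onto it without increasing distances, and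
  in a CAT(0) space the distance to a convex set is convex.\<close>

lemma coordinate_convex:
  assumes p: "comparison_point (orthant_space R V) d b c t p"
    and bc: "b \<in> orthant_space R V" "c \<in> orthant_space R V" and t: "0 \<le> t" "t \<le> 1"
  shows "p u \<le> (1 - t) * b u + t * c u"
proof -
  let ?b = "b(u := 0)" and ?c = "c(u := 0)"
  have bc': "?b \<in> orthant_space R V" "?c \<in> orthant_space R V"
    using bc by (auto intro: zero_coordinate_mem)
  then obtain q where q: "comparison_point (orthant_space R V) d ?b ?c t q"
    using ex_comparison_point t by blast
  have M: "p \<in> orthant_space R V" "q \<in> orthant_space R V" "q(u := 0) \<in> orthant_space R V"
    using p q by (auto dest: comparison_pointD intro: zero_coordinate_mem)
  have "d ?b (q(u := 0)) \<le> d ?b q" "d (q(u := 0)) ?c \<le> d q ?c"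
    using retract[OF bc'(1) M(2), of u] retract[OF M(2) bc'(2), of u] by simp_all
  then have "q(u := 0) = q"
    using comparison_point_unique[OF q M(3) t] comparison_point_dist[OF q bc' t] by simp
  then have "q u = 0" by (metis fun_upd_same)
  then have "p u \<le> d p q"
    using coordinate_le_dist[OF M(1,2), of u] by simp
  also have "\<dots> \<le> (1 - t) * d b ?b + t * d c ?c"
    using dist_convex[OF p q] bc bc' t by blast
  finally show ?thesis
    using dist_zero_coordinate bc by simp
qed

lemma face_convex:
  assumes "L \<subseteq> V" and p: "comparison_point (orthant_space R V) d b c t p"
    and bc: "b \<in> orthant_space R L" "c \<in> orthant_space R L" and t: "0 \<le> t" "t \<le> 1"
  shows "p \<in> orthant_space R L"
proof -
  have sub: "orthant_space R L \<subseteq> orthant_space R V"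
    using assms(1) by (auto simp: orthant_space_def)
  have pV: "p \<in> orthant_space R V" using p by (rule comparison_pointD)
  have "p u = 0" if "u \<notin> L" for u
    using coordinate_convex[OF p, of u] orthant_spaceD(1)[OF bc(1) that] orthant_spaceD(1)[OF bc(2) that]
      orthant_spaceD(2)[OF pV, of u] bc sub t by auto
  then show ?thesis
    using pV by (auto simp: orthant_space_def)
qed

text \<open>A minimizing sequence is bounded, so a subsequence converges coordinatewise. Its limit shares an
  orthant with all late members of the subsequence, hence it is also a limit in the metric \<open>d\<close>.\<close>

lemma attains_minimum_on_face:
  assumes L: "L \<subseteq> V" and x: "x \<in> orthant_space R V"
    and coercive: "\<And>z. z \<in> orthant_space R L \<Longrightarrow> d x z \<le> F z"
    and lipschitz: "\<And>z w. z \<in> orthant_space R L \<Longrightarrow> w \<in> orthant_space R L \<Longrightarrow> F z \<le> F w + K * d z w"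
  shows "\<exists>z\<in>orthant_space R L. \<forall>w\<in>orthant_space R L. F z \<le> F w"
proof -
  have sub: "orthant_space R L \<subseteq> orthant_space R V"
    using L by (auto simp: orthant_space_def)
  define I where "I = Inf (F ` orthant_space R L)"
  have "0 \<le> F z" if "z \<in> orthant_space R L" for z
    using coercive[OF that] nonneg[of x z] by linarith
  then have bdd: "bdd_below (F ` orthant_space R L)" by (auto intro!: bdd_belowI2[of _ 0])
  have ne: "F ` orthant_space R L \<noteq> {}"
    by (auto simp: orthant_space_def intro!: exI[of _ "\<lambda>_. 0"])
  have I_le: "I \<le> F z" if "z \<in> orthant_space R L" for z
    unfolding I_def using bdd that by (auto intro: cInf_lower)
  have "\<exists>z. z \<in> orthant_space R L \<and> F z < I + 1 / real (Suc n)" for n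
    using cInf_lessD[OF ne, of "I + 1 / real (Suc n)"] by (auto simp: I_def)
  then obtain \<sigma> where \<sigma>: "\<And>n. \<sigma> n \<in> orthant_space R L" "\<And>n. F (\<sigma> n) < I + 1 / real (Suc n)"
    by metis
  have bound: "\<bar>\<sigma> n u\<bar> \<le> \<bar>x u\<bar> + I + 1" for n u
  proof -
    have "\<bar>x u - \<sigma> n u\<bar> \<le> d x (\<sigma> n)"
      using coordinate_le_dist[OF x] \<sigma>(1) sub by blast
    also have "\<dots> \<le> F (\<sigma> n)"
      using coercive \<sigma>(1) .
    also have "\<dots> < I + 1 / real (Suc n)"
      by (rule \<sigma>(2))
    also have "\<dots> \<le> I + 1"
      by simp
    finally show ?thesis by linarith
  qed
  have "\<forall>\<delta>\<subseteq>V. \<exists>l::'v \<Rightarrow> real. \<exists>r::nat \<Rightarrow> nat. strict_mono r \<and>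
      (\<forall>\<epsilon>>0. eventually (\<lambda>n. \<forall>i\<in>\<delta>. dist (\<sigma> (r n) i) (l i) < \<epsilon>) sequentially)"
    by (rule compact_lemma_general[where unproj = "\<lambda>x. x"])
      (use bound in \<open>auto simp: finite_V intro!: boundedI\<close>)
  then obtain l0 :: "'v \<Rightarrow> real" and r where r: "strict_mono r"
    and lim0: "\<And>\<epsilon>. 0 < \<epsilon> \<Longrightarrow> eventually (\<lambda>n. \<forall>i\<in>V. dist (\<sigma> (r n) i) (l0 i) < \<epsilon>) sequentially"
    by blast
  define l where "l = (\<lambda>u. if u \<in> L then l0 u else 0)"
  have lim: "(\<lambda>n. \<sigma> (r n) u) \<longlonglongrightarrow> l u" for u
  proof (cases "u \<in> L")
    case True
    then have "u \<in> V" using L by blast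
    then have "(\<lambda>n. \<sigma> (r n) u) \<longlonglongrightarrow> l0 u"
      by (auto simp: tendsto_iff intro: eventually_mono[OF lim0])
    then show ?thesis using True by (simp add: l_def)
  next
    case False
    then show ?thesis using orthant_spaceD(1)[OF \<sigma>(1)] by (simp add: l_def)
  qed
  have lL: "l \<in> orthant_space R L"
    unfolding orthant_space_def
  proof (intro CollectI conjI allI impI)
    show "l u = 0" if "u \<notin> L" for u using that by (simp add: l_def)
    show "0 \<le> l u" for u
      using lim by (rule tendsto_lowerbound) (auto simp: orthant_spaceD(2)[OF \<sigma>(1)])
    show "R u w" if "0 < l u" "0 < l w" for u w
    proof -
      have "\<forall>\<^sub>F n in sequentially. 0 < \<sigma> (r n) u \<and> 0 < \<sigma> (r n) w"
        using that by (intro eventually_conj order_tendstoD(1)[OF lim])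
      then obtain n where "0 < \<sigma> (r n) u" "0 < \<sigma> (r n) w"
        by (auto dest!: eventually_happens)
      then show ?thesis using orthant_spaceD(3)[OF \<sigma>(1)] by blast
    qed
  qed
  have "(\<lambda>n. \<Sum>u\<in>V. (l u - \<sigma> (r n) u)\<^sup>2) \<longlonglongrightarrow> (\<Sum>u\<in>V. (l u - l u)\<^sup>2)"
    by (intro tendsto_intros lim)
  then have euc: "(\<lambda>n. euclid V l (\<sigma> (r n))) \<longlonglongrightarrow> 0"
    unfolding euclid_def L2_set_def by (auto dest: tendsto_real_sqrt)
  obtain \<delta> where "0 < \<delta>" "\<forall>y\<in>orthant_space R V. euclid V l y < \<delta> \<longrightarrow> d l y = euclid V l y"
    using locally_euclid lL sub by blast
  then have "euclid V l (\<sigma> (r n)) = d l (\<sigma> (r n))" if "euclid V l (\<sigma> (r n)) < \<delta>" for n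
    using that \<sigma>(1)[of "r n"] sub by fastforce
  then have "\<forall>\<^sub>F n in sequentially. euclid V l (\<sigma> (r n)) = d l (\<sigma> (r n))"
    by (rule eventually_mono[OF order_tendstoD(2)[OF euc \<open>0 < \<delta>\<close>]])
  with euc have d0: "(\<lambda>n. d l (\<sigma> (r n))) \<longlonglongrightarrow> 0"
    by (rule Lim_transform_eventually)
  have "(\<lambda>n. 1 / real (Suc (r n))) \<longlonglongrightarrow> 0"
    using LIMSEQ_subseq_LIMSEQ[OF LIMSEQ_inverse_real_of_nat r] by (simp add: o_def inverse_eq_divide)
  then have "(\<lambda>n. I + 1 / real (Suc (r n)) + K * d l (\<sigma> (r n))) \<longlonglongrightarrow> I + 0 + K * 0"
    by (intro tendsto_intros d0)
  moreover have "F l \<le> I + 1 / real (Suc (r n)) + K * d l (\<sigma> (r n))" for n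
    using lipschitz[OF lL \<sigma>(1)[of "r n"]] \<sigma>(2)[of "r n"] by linarith
  ultimately have "F l \<le> I + 0 + K * 0"
    by (intro tendsto_lowerbound) auto
  then show ?thesis
    using lL I_le by force
qed

end

section \<open>Adding one coordinate\<close>

lemma sqrt_sum_squares_mono:
  fixes a b c :: real
  shows "0 \<le> a \<Longrightarrow> a \<le> b \<Longrightarrow> sqrt (a\<^sup>2 + c\<^sup>2) \<le> sqrt (b\<^sup>2 + c\<^sup>2)"
  by (simp add: power_mono)

text \<open>The coordinate \<open>v\<close> must be compatible with itself: otherwise it would vanish at every point, and the
  cylinder below would leave the space of orthants.\<close>

locale add_vertex = orthant_metric R W d for R :: "'v \<Rightarrow> 'v \<Rightarrow> bool" and W d +
  fixes v :: 'v
  assumes v_notin: "v \<notin> W" and refl_v: "R v v"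
begin

definition link :: "'v set" where
  "link = {u \<in> W. R u v \<and> R v u}"

text \<open>The points whose support together with \<open>v\<close> is compatible: the product of the orthant space of the link
  with a half-line for the coordinate \<open>v\<close>.\<close>

definition cylinder :: "('v \<Rightarrow> real) set" where
  "cylinder = {x. x(v := 0) \<in> orthant_space R link \<and> 0 \<le> x v}"

definition cylinder_dist :: "('v \<Rightarrow> real) \<Rightarrow> ('v \<Rightarrow> real) \<Rightarrow> real" where
  "cylinder_dist x y = sqrt ((d (x(v := 0)) (y(v := 0)))\<^sup>2 + (x v - y v)\<^sup>2)"

lemma link_subset: "link \<subseteq> W"
  by (auto simp: link_def)

lemma face_subset: "orthant_space R link \<subseteq> orthant_space R W"
  using link_subset by (auto simp: orthant_space_def)

lemma v_coordinate: "x \<in> orthant_space R W \<Longrightarrow> x v = 0"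
  using orthant_spaceD(1)[of x R W v] v_notin by blast

lemma zero_v: "x \<in> orthant_space R W \<Longrightarrow> x(v := 0) = x"
  by (simp add: v_coordinate fun_upd_idem)

lemma cylinder_base: "x \<in> cylinder \<Longrightarrow> x(v := 0) \<in> orthant_space R W"
  using face_subset by (auto simp: cylinder_def)

lemma overlap: "orthant_space R W \<inter> cylinder = orthant_space R link"
proof (intro equalityI subsetI)
  show "x \<in> orthant_space R link" if "x \<in> orthant_space R W \<inter> cylinder" for x
    using that zero_v[of x] by (simp add: cylinder_def)
  show "x \<in> orthant_space R W \<inter> cylinder" if x: "x \<in> orthant_space R link" for x
  proof -
    have "x \<in> orthant_space R W" using x face_subset by blast
    then show ?thesis using x zero_v[of x] v_coordinate[of x] by (simp add: cylinder_def)
  qed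
qed

lemma link_space_mem_cylinder: "x \<in> orthant_space R link \<Longrightarrow> x \<in> cylinder"
  using overlap by blast

lemma cover: "orthant_space R W \<union> cylinder = orthant_space R (insert v W)"
proof (intro equalityI subsetI)
  fix x assume "x \<in> orthant_space R W \<union> cylinder"
  then show "x \<in> orthant_space R (insert v W)"
  proof
    assume "x \<in> orthant_space R W"
    then show ?thesis by (auto simp: orthant_space_def)
  next
    assume "x \<in> cylinder"
    then have x: "x(v := 0) \<in> orthant_space R link" "0 \<le> x v" by (auto simp: cylinder_def)
    have off: "x u = 0" if "u \<notin> link" "u \<noteq> v" for u
      using orthant_spaceD(1)[OF x(1) that(1)] that(2) by simp
    have pos: "0 \<le> x u" for u
      using orthant_spaceD(2)[OF x(1), of u] x(2) by (cases "u = v") auto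
    have inL: "u \<in> link" if "0 < x u" "u \<noteq> v" for u
      using off that by force
    have "R u w" if "0 < x u" "0 < x w" for u w
    proof (cases "u = v \<or> w = v")
      case True
      then show ?thesis using inL that refl_v by (auto simp: link_def)
    next
      case False
      then show ?thesis using orthant_spaceD(3)[OF x(1), of u w] that by simp
    qed
    moreover have "x u = 0" if "u \<notin> insert v W" for u
      using off[of u] that link_subset by blast
    ultimately show ?thesis using pos unfolding orthant_space_def by blast
  qed
next
  fix x assume x: "x \<in> orthant_space R (insert v W)"
  show "x \<in> orthant_space R W \<union> cylinder"
  proof (cases "x v = 0")
    case True
    then have "x \<in> orthant_space R W"
      using x by (auto simp: orthant_space_def)
    then show ?thesis by simp
  next
    case False
    then have v: "0 < x v" using orthant_spaceD(2)[OF x, of v] by simp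
    have "u \<in> link" if "0 < x u" "u \<noteq> v" for u
      using that v orthant_spaceD(1)[OF x, of u] orthant_spaceD(3)[OF x, of u v] orthant_spaceD(3)[OF x, of v u]
      by (auto simp: link_def)
    then have "x(v := 0) \<in> orthant_space R link"
      using orthant_spaceD(2,3)[OF x] unfolding orthant_space_def
      by (auto simp: order_less_le split: if_splits)
    then show ?thesis using v by (simp add: cylinder_def)
  qed
qed

lemma cylinder_dist_base:
  "x \<in> orthant_space R W \<Longrightarrow> y \<in> orthant_space R W \<Longrightarrow> cylinder_dist x y = d x y"
  by (simp add: cylinder_dist_def zero_v v_coordinate)

sublocale cylinder: Metric_space cylinder cylinder_dist
proof
  show "0 \<le> cylinder_dist x y" "cylinder_dist x y = cylinder_dist y x" for x y
    by (simp_all add: cylinder_dist_def commute power2_commute)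
  show "cylinder_dist x y = 0 \<longleftrightarrow> x = y" if "x \<in> cylinder" "y \<in> cylinder" for x y
  proof
    assume "cylinder_dist x y = 0"
    then have "x(v := 0) = y(v := 0)" "x v = y v"
      using cylinder_base that by (auto simp: cylinder_dist_def sum_power2_eq_zero_iff)
    then show "x = y" by (metis fun_upd_triv fun_upd_upd)
  next
    assume "x = y"
    then show "cylinder_dist x y = 0" using cylinder_base[OF that(1)] by (simp add: cylinder_dist_def)
  qed
  show "cylinder_dist x z \<le> cylinder_dist x y + cylinder_dist y z" if "x \<in> cylinder" "y \<in> cylinder" "z \<in> cylinder" for x y z
  proof -
    have "cylinder_dist x z \<le> sqrt ((d (x(v := 0)) (y(v := 0)) + d (y(v := 0)) (z(v := 0)))\<^sup>2 + (x v - z v)\<^sup>2)"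
      unfolding cylinder_dist_def using that[THEN cylinder_base] triangle
      by (intro sqrt_sum_squares_mono) auto
    also have "x v - z v = (x v - y v) + (y v - z v)"
      by simp
    also have "sqrt ((d (x(v := 0)) (y(v := 0)) + d (y(v := 0)) (z(v := 0)))\<^sup>2 + ((x v - y v) + (y v - z v))\<^sup>2)
        \<le> cylinder_dist x y + cylinder_dist y z"
      unfolding cylinder_dist_def by (rule real_sqrt_sum_squares_triangle_ineq)
    finally show ?thesis .
  qed
qed

lemma cylinder_comparison_point:
  assumes p: "comparison_point (orthant_space R W) d (b(v := 0)) (c(v := 0)) t p"
    and bc: "b \<in> cylinder" "c \<in> cylinder" and t: "0 \<le> t" "t \<le> 1"
  shows "p \<in> orthant_space R link"
    and "comparison_point cylinder cylinder_dist b c t (p(v := (1 - t) * b v + t * c v))"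
proof -
  show pL: "p \<in> orthant_space R link"
    using face_convex[OF link_subset p] bc t by (auto simp: cylinder_def)
  then have pW: "p \<in> orthant_space R W" using face_subset by blast
  let ?p = "p(v := (1 - t) * b v + t * c v)"
  have base: "?p(v := 0) = p" using zero_v[OF pW] by simp
  show "comparison_point cylinder cylinder_dist b c t ?p"
    unfolding comparison_point_def
  proof (intro conjI ballI)
    show "?p \<in> cylinder"
      using pL bc t base unfolding cylinder_def by simp
    fix a assume a: "a \<in> cylinder"
    have "(d (a(v := 0)) p)\<^sup>2 \<le> (1 - t) * (d (a(v := 0)) (b(v := 0)))\<^sup>2 + t * (d (a(v := 0)) (c(v := 0)))\<^sup>2
        - t * (1 - t) * (d (b(v := 0)) (c(v := 0)))\<^sup>2"
      using comparison_pointD(2)[OF p cylinder_base[OF a]] .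
    moreover have "(a v - ?p v)\<^sup>2 = (1 - t) * (a v - b v)\<^sup>2 + t * (a v - c v)\<^sup>2 - t * (1 - t) * (b v - c v)\<^sup>2"
      by (simp add: power2_eq_square algebra_simps)
    ultimately show "(cylinder_dist a ?p)\<^sup>2 \<le> (1 - t) * (cylinder_dist a b)\<^sup>2 + t * (cylinder_dist a c)\<^sup>2
        - t * (1 - t) * (cylinder_dist b c)\<^sup>2"
      unfolding cylinder_dist_def base by (simp add: algebra_simps)
  qed
qed

sublocale cylinder: cat0 cylinder cylinder_dist
proof
  fix b c :: "'v \<Rightarrow> real" and t :: real
  assume *: "b \<in> cylinder" "c \<in> cylinder" "0 \<le> t" "t \<le> 1"
  obtain p where "comparison_point (orthant_space R W) d (b(v := 0)) (c(v := 0)) t p"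
    using ex_comparison_point[OF cylinder_base cylinder_base] * by blast
  then show "\<exists>p. comparison_point cylinder cylinder_dist b c t p"
    using cylinder_comparison_point(2) * by blast
qed

sublocale glue: gluing "orthant_space R W" d cylinder cylinder_dist
proof
  show "d x y = cylinder_dist x y" if "x \<in> orthant_space R W \<inter> cylinder" "y \<in> orthant_space R W \<inter> cylinder" for x y
    using that cylinder_dist_base by auto
  show "\<exists>p. comparison_point (orthant_space R W) d b c t p \<and> comparison_point cylinder cylinder_dist b c t p"
    if bc: "b \<in> orthant_space R W \<inter> cylinder" "c \<in> orthant_space R W \<inter> cylinder" and t: "0 \<le> t" "t \<le> 1" for b c t
  proof -
    obtain p where p: "comparison_point (orthant_space R W) d b c t p"
      using ex_comparison_point bc t by blast
    then have "comparison_point cylinder cylinder_dist b c t (p(v := (1 - t) * b v + t * c v))"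
      using bc t by (intro cylinder_comparison_point(2)) (auto simp: zero_v)
    moreover have "p(v := (1 - t) * b v + t * c v) = p"
      using bc comparison_pointD(1)[OF p] by (simp add: v_coordinate zero_v)
    ultimately show ?thesis using p by auto
  qed
  show "\<exists>z\<in>orthant_space R W \<inter> cylinder. \<forall>w\<in>orthant_space R W \<inter> cylinder. d x z + cylinder_dist z y \<le> d x w + cylinder_dist w y"
    if x: "x \<in> orthant_space R W" and y: "y \<in> cylinder" for x y
    unfolding overlap
  proof (rule attains_minimum_on_face[OF link_subset x])
    show "d x z \<le> d x z + cylinder_dist z y" for z by simp
    show "d x z + cylinder_dist z y \<le> d x w + cylinder_dist w y + 2 * d z w"
      if zw: "z \<in> orthant_space R link" "w \<in> orthant_space R link" for z w
    proof -
      have W: "z \<in> orthant_space R W" "w \<in> orthant_space R W" using zw face_subset by auto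
      have "d x z \<le> d x w + d z w"
        using triangle[OF x W(2,1)] by (simp add: commute)
      moreover have "cylinder_dist z y \<le> d z w + cylinder_dist w y"
        using cylinder.triangle[of z w y] zw y link_space_mem_cylinder by (simp add: cylinder_dist_base W)
      ultimately show ?thesis by simp
    qed
  qed
qed

lemma cylinder_zero_coordinate:
  assumes "x \<in> cylinder"
  shows "x(u := 0) \<in> cylinder"
proof (cases "u = v")
  case True
  then show ?thesis using assms by (simp add: cylinder_def)
next
  case False
  then show ?thesis
    using assms zero_coordinate_mem[of "x(v := 0)" R link u] by (simp add: cylinder_def fun_upd_twist)
qed

lemma cylinder_retract:
  assumes "x \<in> cylinder" "y \<in> cylinder"
  shows "cylinder_dist (x(u := 0)) (y(u := 0)) \<le> cylinder_dist x y"
proof (cases "u = v")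
  case True
  then show ?thesis by (simp add: cylinder_dist_def)
next
  case False
  have "d ((x(v := 0))(u := 0)) ((y(v := 0))(u := 0)) \<le> d (x(v := 0)) (y(v := 0))"
    using retract assms cylinder_base by blast
  then show ?thesis
    using False sqrt_sum_squares_mono[OF nonneg] by (simp add: cylinder_dist_def fun_upd_twist)
qed

lemma euclid_base:
  "x \<in> orthant_space R W \<Longrightarrow> y \<in> orthant_space R W \<Longrightarrow> euclid (insert v W) x y = euclid W x y"
  by (simp add: euclid_insert[OF finite_V v_notin] zero_v v_coordinate euclid_nonneg)

lemma euclid_cylinder:
  assumes "x \<in> cylinder" "y \<in> cylinder"
  shows "euclid (insert v W) x y \<le> cylinder_dist x y"
  unfolding euclid_insert[OF finite_V v_notin] cylinder_dist_def
  using assms by (intro sqrt_sum_squares_mono euclid_le cylinder_base euclid_nonneg)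

text \<open>Two points of a common orthant lie in a common piece: if the coordinate \<open>v\<close> vanishes at both, in the old
  space; otherwise \<open>v\<close> is compatible with both supports, so both points lie in the cylinder. Here it
  matters that compatibility is a condition on pairs.\<close>

lemma glued_flat:
  assumes xy: "x \<in> orthant_space R (insert v W)" "y \<in> orthant_space R (insert v W)"
    and share: "share_orthant R x y"
  shows "glue.glued_dist x y = euclid (insert v W) x y"
proof (cases "x v = 0 \<and> y v = 0")
  case True
  then have W: "x \<in> orthant_space R W" "y \<in> orthant_space R W"
    using xy by (auto simp: orthant_space_def)
  then show ?thesis
    using flat[OF W share] by (simp add: glue.glued_dist_11 euclid_base)
next
  case False
  then have v: "0 < x v \<or> 0 < y v"
    using orthant_spaceD(2)[OF xy(1), of v] orthant_spaceD(2)[OF xy(2), of v] by linarith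
  have inL: "u \<in> link" if u: "0 < x u \<or> 0 < y u" "u \<noteq> v" for u
  proof -
    have "u \<in> insert v W"
      using u(1) orthant_spaceD(1)[OF xy(1), of u] orthant_spaceD(1)[OF xy(2), of u] by force
    moreover have "R u v" "R v u"
      using share u(1) v unfolding share_orthant_def by blast+
    ultimately show ?thesis using u(2) by (simp add: link_def)
  qed
  have mem: "z \<in> cylinder" if z: "z \<in> orthant_space R (insert v W)" and "\<And>u. 0 < z u \<Longrightarrow> u \<noteq> v \<Longrightarrow> u \<in> link" for z
  proof -
    have "z(v := 0) \<in> orthant_space R link"
      using that(2) orthant_spaceD(2,3)[OF z] unfolding orthant_space_def
      by (auto simp: order_less_le split: if_splits)
    then show ?thesis using orthant_spaceD(2)[OF z, of v] by (simp add: cylinder_def)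
  qed
  have B: "x \<in> cylinder" "y \<in> cylinder"
    using mem xy inL by blast+
  have "share_orthant R (x(v := 0)) (y(v := 0))"
    using share unfolding share_orthant_def by (auto split: if_splits)
  then have "d (x(v := 0)) (y(v := 0)) = euclid W (x(v := 0)) (y(v := 0))"
    using B by (intro flat cylinder_base)
  then show ?thesis
    by (simp add: glue.glued_dist_22[OF B] cylinder_dist_def euclid_insert[OF finite_V v_notin])
qed

theorem orthant_metric_glued: "orthant_metric R (insert v W) glue.glued_dist"
proof -
  interpret N: cat0 "orthant_space R (insert v W)" glue.glued_dist
    using glue.glued_cat0 unfolding cover .
  show ?thesis
  proof
    show "finite (insert v W)" using finite_V by simp
    show "glue.glued_dist x y = euclid (insert v W) x y"
      if "x \<in> orthant_space R (insert v W)" "y \<in> orthant_space R (insert v W)" "share_orthant R x y" for x y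
      using glued_flat that .
    have cross: "euclid (insert v W) x y \<le> glue.cross x y \<and> glue.cross (x(u := 0)) (y(u := 0)) \<le> glue.cross x y"
      if xy: "x \<in> orthant_space R W" "y \<in> cylinder" for x y u
    proof -
      obtain z where z: "z \<in> orthant_space R W" "z \<in> cylinder" "glue.cross x y = d x z + cylinder_dist z y"
        using glue.cross_attained[OF xy] by blast
      have "euclid (insert v W) x y \<le> euclid W x z + euclid (insert v W) z y"
        using euclid_triangle[of "insert v W" x y z] xy z by (simp add: euclid_base)
      also have "\<dots> \<le> d x z + cylinder_dist z y"
        using xy z by (intro add_mono euclid_le euclid_cylinder)
      finally have 1: "euclid (insert v W) x y \<le> glue.cross x y" using z by simp
      have "z(u := 0) \<in> orthant_space R W \<inter> cylinder"
        using z by (intro IntI zero_coordinate_mem cylinder_zero_coordinate)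
      then have "glue.cross (x(u := 0)) (y(u := 0)) \<le> d (x(u := 0)) (z(u := 0)) + cylinder_dist (z(u := 0)) (y(u := 0))"
        by (rule glue.cross_le)
      also have "\<dots> \<le> d x z + cylinder_dist z y"
        using xy z by (intro add_mono retract cylinder_retract)
      finally show ?thesis using 1 z by simp
    qed
    fix x y u
    assume "x \<in> orthant_space R (insert v W)" "y \<in> orthant_space R (insert v W)"
    then have "x \<in> orthant_space R W \<union> cylinder" "y \<in> orthant_space R W \<union> cylinder"
      unfolding cover by auto
    then consider "x \<in> orthant_space R W" "y \<in> orthant_space R W" | "x \<in> cylinder" "y \<in> cylinder"
      | "x \<in> orthant_space R W" "y \<in> cylinder" | "x \<in> cylinder" "y \<in> orthant_space R W"
      by blast
    then have "euclid (insert v W) x y \<le> glue.glued_dist x y \<and> glue.glued_dist (x(u := 0)) (y(u := 0)) \<le> glue.glued_dist x y"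
    proof cases
      case 1
      then show ?thesis
        using euclid_le retract by (simp add: glue.glued_dist_11 euclid_base zero_coordinate_mem)
    next
      case 2
      then show ?thesis
        using euclid_cylinder cylinder_retract by (simp add: glue.glued_dist_22 cylinder_zero_coordinate)
    next
      case 3
      then show ?thesis
        using cross by (simp add: glue.glued_dist_12 cylinder_zero_coordinate zero_coordinate_mem)
    next
      case 4
      then show ?thesis
        using cross[of y x u] by (simp add: glue.glued_dist_21 cylinder_zero_coordinate zero_coordinate_mem euclid_commute[of _ x])
    qed
    then show "euclid (insert v W) x y \<le> glue.glued_dist x y" "glue.glued_dist (x(u := 0)) (y(u := 0)) \<le> glue.glued_dist x y"
      by auto
  qed
qed

end

lemma ex_orthant_metric:
  assumes "finite V" and refl: "\<And>u. R u u"
  shows "\<exists>d. orthant_metric R V d"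
  using assms(1)
proof induction
  case empty
  have single: "orthant_space R {} = {\<lambda>_. 0}"
    by (auto simp: orthant_space_def)
  have "orthant_metric R {} (\<lambda>_ _. 0)"
    by unfold_locales (auto simp: single comparison_point_def euclid_def)
  then show ?case by blast
next
  case (insert v W)
  then obtain d where "orthant_metric R W d" by blast
  then interpret add_vertex R W d v
    using insert refl by (auto simp: add_vertex_def add_vertex_axioms_def)
  show ?case using orthant_metric_glued by blast
qed

section \<open>Dendrogram space\<close>

definition compatible :: "nat set \<Rightarrow> nat set \<Rightarrow> bool" where
  "compatible A B \<longleftrightarrow> A \<subseteq> B \<or> B \<subseteq> A \<or> A \<inter> B = {}"

lemma dendrograms_eq:
  "dendrograms m = {x \<in> orthant_space compatible (inner_edges m).
     \<forall>i\<in>{1..m}. (\<Sum>A | A \<in> inner_edges m \<and> i \<in> A. x A) \<le> 1}"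
proof (intro equalityI subsetI)
  fix x assume x: "x \<in> dendrograms m"
  have off: "x A = 0" if "A \<notin> inner_edges m" for A
    using x that by (simp add: dendrograms_def)
  have "0 \<le> x A" for A
    using x off[of A] by (cases "A \<in> inner_edges m") (simp_all add: dendrograms_def)
  moreover have "compatible A B" if pos: "0 < x A" "0 < x B" for A B
  proof -
    have "A \<in> inner_edges m" "B \<in> inner_edges m"
      using off[of A] off[of B] pos by force+
    then show ?thesis using x pos by (simp add: dendrograms_def compatible_def)
  qed
  ultimately have "x \<in> orthant_space compatible (inner_edges m)"
    using off by (simp add: orthant_space_def)
  then show "x \<in> {x \<in> orthant_space compatible (inner_edges m).
      \<forall>i\<in>{1..m}. (\<Sum>A | A \<in> inner_edges m \<and> i \<in> A. x A) \<le> 1}"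
    using x by (simp add: dendrograms_def)
next
  fix x assume "x \<in> {x \<in> orthant_space compatible (inner_edges m).
      \<forall>i\<in>{1..m}. (\<Sum>A | A \<in> inner_edges m \<and> i \<in> A. x A) \<le> 1}"
  then show "x \<in> dendrograms m"
    by (simp add: dendrograms_def orthant_space_def compatible_def)
qed

theorem theorem6p2:
  fixes m :: nat
  shows "CAT0_space (dendrograms m) (dendrogram_dist m)"
proof -
  let ?E = "inner_edges m"
  let ?S = "dendrograms m"
  have "?E \<subseteq> Pow {1..m}" by (auto simp: inner_edges_def)
  then have fin: "finite ?E" by (rule finite_subset) simp
  obtain d where "orthant_metric compatible ?E d"
    using ex_orthant_metric[OF fin, of compatible] by (auto simp: compatible_def)
  then interpret orthant_metric compatible ?E d .
  have sub: "?S \<subseteq> orthant_space compatible ?E"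
    by (auto simp: dendrograms_eq)
  interpret D: cat0 ?S d
  proof (rule convex_subspace[OF sub])
    fix b c p :: "nat set \<Rightarrow> real" and t :: real
    assume bc: "b \<in> ?S" "c \<in> ?S" and t: "0 \<le> t" "t \<le> 1"
      and p: "comparison_point (orthant_space compatible ?E) d b c t p"
    have "(\<Sum>A | A \<in> ?E \<and> i \<in> A. p A) \<le> 1" if i: "i \<in> {1..m}" for i
    proof -
      have "(\<Sum>A | A \<in> ?E \<and> i \<in> A. p A) \<le> (\<Sum>A | A \<in> ?E \<and> i \<in> A. (1 - t) * b A + t * c A)"
        using coordinate_convex[OF p _ _ t] bc sub by (intro sum_mono) blast
      also have "\<dots> = (1 - t) * (\<Sum>A | A \<in> ?E \<and> i \<in> A. b A) + t * (\<Sum>A | A \<in> ?E \<and> i \<in> A. c A)"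
        by (simp add: sum.distrib sum_distrib_left)
      also have "\<dots> \<le> (1 - t) * 1 + t * 1"
        using bc i t by (intro add_mono mult_left_mono) (auto simp: dendrograms_eq)
      finally show ?thesis by simp
    qed
    then show "p \<in> ?S"
      using comparison_pointD(1)[OF p] by (simp add: dendrograms_eq)
  qed
  have edge_dist: "edge_dist m = euclid ?E"
    by (intro ext) (simp add: edge_dist_def euclid_def)
  have E: "Metric_space ?S (edge_dist m)"
    unfolding edge_dist by (rule Metric_space_euclid[OF fin]) (auto simp: dendrograms_def)
  have eq: "dendrogram_dist m x y = d x y" if "x \<in> ?S" "y \<in> ?S" for x y
    unfolding dendrogram_dist_def
  proof (rule length_dist_eq[OF E D.Metric_space_axioms])
    show "edge_dist m x y \<le> d x y" if "x \<in> ?S" "y \<in> ?S" for x y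
      using euclid_le that sub by (auto simp: edge_dist)
    show "\<exists>\<delta>>0. \<forall>y\<in>?S. edge_dist m x y < \<delta> \<longrightarrow> d x y = edge_dist m x y" if "x \<in> ?S" for x
      using locally_euclid[of x] that sub unfolding edge_dist by blast
  qed (use that D.geodesic_exists in auto)
  have outside: "dendrogram_dist m x y = 0" if "x \<notin> ?S \<or> y \<notin> ?S" for x y
    unfolding dendrogram_dist_def by (rule length_dist_outside[OF E that])
  interpret L: cat0 ?S "dendrogram_dist m"
  proof
    show "0 \<le> dendrogram_dist m x y" for x y
      by (simp add: dendrogram_dist_def length_dist_nonneg)
    show "dendrogram_dist m x y = dendrogram_dist m y x" for x y
      using eq outside D.commute by (cases "x \<in> ?S \<and> y \<in> ?S") auto
    show "dendrogram_dist m x y = 0 \<longleftrightarrow> x = y" if "x \<in> ?S" "y \<in> ?S" for x y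
      using that by (simp add: eq)
    show "dendrogram_dist m x z \<le> dendrogram_dist m x y + dendrogram_dist m y z"
      if "x \<in> ?S" "y \<in> ?S" "z \<in> ?S" for x y z
      using that D.triangle by (simp add: eq)
    show "\<exists>p. comparison_point ?S (dendrogram_dist m) b c t p"
      if bc: "b \<in> ?S" "c \<in> ?S" and t: "0 \<le> t" "t \<le> 1" for b c t
    proof -
      obtain p where p: "comparison_point ?S d b c t p"
        using D.ex_comparison_point bc t by blast
      then show ?thesis
        using bc unfolding comparison_point_def by (auto simp: eq)
    qed
  qed
  show ?thesis by (rule L.CAT0_space)
qed

end
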